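(* Let $d_1,\dots,d_p\ge0$ be integers with $d_p>0$ and $\mathfrak l=\sum_id_i\le\min(k,m)$, let $n_{\min}=\sum_i i\,d_i$, let $F$ be the nilpotent Jordan matrix $\mathrm{diag}(K(p,d_p),\dots,K(1,d_1))$, and let $\mathcal S=\mathrm{Centr}(F)$ be the group of invertible $n_{\min}\times n_{\min}$ matrices commuting with $F$. For any block matrix $G\in\mathrm{Mat}(n_{\min},m)$ such that $G_{:,0}$ is of full row rank, one can construct $S\in\mathcal S$ such that $G^o=SG$ satisfies $$G^o_{:,0}\,(G^{o}_{:,0})'=I_{\mathfrak l}\qquad(\mathrm{i})$$ $$G^o_{\rho,l}\,(G^{o}_{\rho_1,0})'=0\quad\text{for } l>\max(0,\rho-\rho_1-1)\qquad(\mathrm{ii})$$ (for all $1\le\rho,\rho_1\le p$ and $0\le l\le\rho-1$). Moreover, the $\mathfrak l\times\mathfrak l$ matrix $(S_{\rho_1,0;\rho_2,0})_{\rho_1,\rho_2}$ can be chosen to be any block lower triangular matrix (i.e. $S_{\rho_1,0;\rho_2,0}=0$ if $\rho_1>\rho_2$) for which (i) holds, that is, $$(S_{\rho_1,0;\rho_2,0})_{\rho_1,\rho_2}\,G_{:,0}\,G_{:,0}'\,\big((S_{\rho_1,0;\rho_2,0})_{\rho_1,\rho_2}\big)'=I_{\mathfrak l},$$ and once $(S_{\rho_1,0;\rho_2,0})_{\rho_1,\rho_2}$ is chosen, $S$ is uniquely determined by (ii).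
   Context: All matrices are real; $'$ denotes transpose. $K(r,d)=J_r\otimes I_d$ with $J_r$ the $r\times r$ matrix with ones on the first superdiagonal and zeros elsewhere (blocks with $d_r=0$ are skipped). The index set of blocks consists of pairs $(r,j)$, $1\le r\le p$, $0\le j\le r-1$, ordered with $r$ descending from $p$ to $1$ and, for each $r$, $j$ descending from $r-1$ to $0$; the block $(r,j)$ has size $d_r$. The rows of an $n_{\min}\times m$ matrix $G$ are partitioned accordingly into blocks $G_{r,j}$ of size $d_r\times m$. $G_{:,0}$ is the vertical stack of $G_{p,0},G_{p-1,0},\dots,G_{1,0}$. An $n_{\min}\times n_{\min}$ matrix $S$ is partitioned into blocks $S_{\rho_1,j_1;\rho_2,j_2}$ of size $d_{\rho_1}\times d_{\rho_2}$ with $(SG)_{\rho_1,j_1}=\sum_{\rho_2,j_2}S_{\rho_1,j_1;\rho_2,j_2}G_{\rho_2,j_2}$. In $(S_{\rho_1,0;\rho_2,0})_{\rho_1,\rho_2}$ the indices $\rho_1,\rho_2$ run in descending order from $p$ to $1$. *)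

theory Defs
  imports "Jordan_Normal_Form.Jordan_Normal_Form" "Jordan_Normal_Form.DL_Rank"
    "Jordan_Normal_Form.DL_Submatrix"
begin

text \<open>Blocks are selected with \<^const>\<open>submatrix\<close>, which lists the selected rows and columns in
  increasing order; blocks of size 0 are empty matrices. Matrix indices start at 0.\<close>

definition kronecker :: "'a::times mat \<Rightarrow> 'a mat \<Rightarrow> 'a mat" where
  "kronecker A B = mat (dim_row A * dim_row B) (dim_col A * dim_col B)
     (\<lambda>(i, j). A $$ (i div dim_row B, j div dim_col B) * B $$ (i mod dim_row B, j mod dim_col B))"

definition K_mat :: "nat \<Rightarrow> nat \<Rightarrow> real mat" where
  "K_mat r e = kronecker (jordan_block r 0) (1\<^sub>m e)"

definition n_min :: "(nat \<Rightarrow> nat) \<Rightarrow> nat \<Rightarrow> nat" where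
  "n_min d p = (\<Sum>i = 1..p. i * d i)"

text \<open>If \<open>d r = 0\<close>, then \<open>K_mat r (d r)\<close> is the \<open>0 \<times> 0\<close> matrix and contributes nothing.\<close>

definition F_mat :: "(nat \<Rightarrow> nat) \<Rightarrow> nat \<Rightarrow> real mat" where
  "F_mat d p = diag_block_mat (map (\<lambda>r. K_mat r (d r)) (rev [1..<Suc p]))"

definition Centr :: "real mat \<Rightarrow> real mat set" where
  "Centr F = {S \<in> carrier_mat (dim_row F) (dim_row F). invertible_mat S \<and> S * F = F * S}"

text \<open>The positions of the block \<open>(r, j)\<close>: it is preceded by the blocks \<open>(r', j')\<close> with
  \<open>r' > r\<close> and by the blocks \<open>(r, j')\<close> with \<open>j < j' \<le> r - 1\<close>.\<close>

definition block_start :: "(nat \<Rightarrow> nat) \<Rightarrow> nat \<Rightarrow> nat \<Rightarrow> nat \<Rightarrow> nat" where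
  "block_start d p r j = (\<Sum>r' = Suc r..p. r' * d r') + (r - 1 - j) * d r"

definition block_idx :: "(nat \<Rightarrow> nat) \<Rightarrow> nat \<Rightarrow> nat \<Rightarrow> nat \<Rightarrow> nat set" where
  "block_idx d p r j = {block_start d p r j ..< block_start d p r j + d r}"

text \<open>The positions of all the blocks \<open>(r, 0)\<close>. In increasing order they run through
  \<open>(p, 0), (p - 1, 0), \<dots>, (1, 0)\<close>.\<close>

definition zero_idx :: "(nat \<Rightarrow> nat) \<Rightarrow> nat \<Rightarrow> nat set" where
  "zero_idx d p = (\<Union>r \<in> {1..p}. block_idx d p r 0)"

definition row_block :: "(nat \<Rightarrow> nat) \<Rightarrow> nat \<Rightarrow> real mat \<Rightarrow> nat \<Rightarrow> nat \<Rightarrow> real mat" where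
  "row_block d p G r j = submatrix G (block_idx d p r j) UNIV"

definition rows_zero :: "(nat \<Rightarrow> nat) \<Rightarrow> nat \<Rightarrow> real mat \<Rightarrow> real mat" where
  "rows_zero d p G = submatrix G (zero_idx d p) UNIV"

definition zero_part :: "(nat \<Rightarrow> nat) \<Rightarrow> nat \<Rightarrow> real mat \<Rightarrow> real mat" where
  "zero_part d p S = submatrix S (zero_idx d p) (zero_idx d p)"

definition full_row_rank :: "real mat \<Rightarrow> bool" where
  "full_row_rank A \<longleftrightarrow> vec_space.rank (dim_row A) A = dim_row A"

text \<open>An \<open>(\<Sum>i = 1..p. d i)\<close>-square matrix is partitioned into blocks \<open>(\<rho>\<^sub>1, \<rho>\<^sub>2)\<close> of size
  \<open>d \<rho>\<^sub>1 \<times> d \<rho>\<^sub>2\<close>, both indices descending from \<open>p\<close> to \<open>1\<close>. The blocks above the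
  diagonal are therefore those with \<open>\<rho>\<^sub>1 > \<rho>\<^sub>2\<close>.\<close>

definition level_idx :: "(nat \<Rightarrow> nat) \<Rightarrow> nat \<Rightarrow> nat \<Rightarrow> nat set" where
  "level_idx d p r = {(\<Sum>r' = Suc r..p. d r') ..< (\<Sum>r' = Suc r..p. d r') + d r}"

definition block_lower_triangular :: "(nat \<Rightarrow> nat) \<Rightarrow> nat \<Rightarrow> real mat \<Rightarrow> bool" where
  "block_lower_triangular d p L \<longleftrightarrow>
     (\<forall>\<rho>\<^sub>1 \<in> {1..p}. \<forall>\<rho>\<^sub>2 \<in> {1..p}. \<rho>\<^sub>1 > \<rho>\<^sub>2 \<longrightarrow>
        submatrix L (level_idx d p \<rho>\<^sub>1) (level_idx d p \<rho>\<^sub>2) = 0\<^sub>m (d \<rho>\<^sub>1) (d \<rho>\<^sub>2))"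

definition cond_i :: "(nat \<Rightarrow> nat) \<Rightarrow> nat \<Rightarrow> real mat \<Rightarrow> bool" where
  "cond_i d p G \<longleftrightarrow> rows_zero d p G * transpose_mat (rows_zero d p G) = 1\<^sub>m (\<Sum>i = 1..p. d i)"

definition cond_ii :: "(nat \<Rightarrow> nat) \<Rightarrow> nat \<Rightarrow> real mat \<Rightarrow> bool" where
  "cond_ii d p G \<longleftrightarrow>
     (\<forall>\<rho> \<in> {1..p}. \<forall>\<rho>\<^sub>1 \<in> {1..p}. \<forall>l. l \<le> \<rho> - 1 \<and> int l > max 0 (int \<rho> - int \<rho>\<^sub>1 - 1) \<longrightarrow>
        row_block d p G \<rho> l * transpose_mat (row_block d p G \<rho>\<^sub>1 0) = 0\<^sub>m (d \<rho>) (d \<rho>\<^sub>1))"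

end

theory Submission
  imports Defs
begin

text \<open>A matrix commutes with \<open>F\<close> iff its blocks \<open>S\<^bsub>\<rho>,j;\<rho>',j'\<^esub>\<close> depend only on \<open>j - j'\<close> and vanish unless
  \<open>j - j' \<ge> max 0 (\<rho> - \<rho>')\<close>. Hence \<open>(S G)\<^bsub>:,0\<^esub> = L G\<^bsub>:,0\<^esub>\<close>, where \<open>L\<close> is the block lower triangular matrix
  of the blocks \<open>S\<^bsub>\<rho>,0;\<rho>',0\<^esub>\<close>; Gram-Schmidt orthonormalization of the rows of \<open>G\<^bsub>:,0\<^esub>\<close> provides an \<open>L\<close>
  satisfying (i). With \<open>Q = L G\<^bsub>:,0\<^esub>\<close> the matrix \<open>M
      = G\<^bsub>:,0\<^esub> Q'\<close> is a right inverse of \<open>L\<close>, so by triangularity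
  its minors on the levels \<open>\<rho>' \<ge> c\<close> are invertible. For fixed \<open>\<rho>\<close> and \<open>l > 0\<close>, condition (ii) is a linear
  system for the blocks \<open>S\<^bsub>\<rho>,l;\<rho>',0\<^esub>\<close> with \<open>\<rho>' \<ge> \<rho> - l\<close>: its matrix is such a minor and its right-hand side
  depends only on smaller \<open>l\<close>. Recursion on \<open>l\<close> thus gives existence and uniqueness.\<close>

subsection \<open>Labels of rows and blocks\<close>

text \<open>A row of \<open>G\<close> is labelled by \<open>(r, j, a)\<close>, the row \<open>a\<close> of the block \<open>(r, j)\<close>; a row of the
  stack of the blocks \<open>(r, 0)\<close> is labelled by \<open>(r, a)\<close>.\<close>

definition blocks :: "(nat \<Rightarrow> nat) \<Rightarrow> nat \<Rightarrow> (nat \<times> nat \<times> nat) set" where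
  "blocks d p = (SIGMA r:{1..p}. {..<r} \<times> {..<d r})"

definition levels :: "(nat \<Rightarrow> nat) \<Rightarrow> nat \<Rightarrow> (nat \<times> nat) set" where
  "levels d p = (SIGMA r:{1..p}. {..<d r})"

fun block_pos :: "(nat \<Rightarrow> nat) \<Rightarrow> nat \<Rightarrow> nat \<times> nat \<times> nat \<Rightarrow> nat" where
  "block_pos d p (r, j, a) = block_start d p r j + a"

fun level_pos :: "(nat \<Rightarrow> nat) \<Rightarrow> nat \<Rightarrow> nat \<times> nat \<Rightarrow> nat" where
  "level_pos d p (r, a) = (\<Sum>r' = Suc r..p. d r') + a"

fun at_zero :: "nat \<times> nat \<Rightarrow> nat \<times> nat \<times> nat" where
  "at_zero (r, a) = (r, 0, a)"

lemma blocks_iff [simp]: "(r, j, a) \<in> blocks d p \<longleftrightarrow> 1 \<le> r \<and> r \<le> p \<and> j < r \<and> a < d r"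
  by (auto simp: blocks_def)

lemma levels_iff [simp]: "(r, a) \<in> levels d p \<longleftrightarrow> 1 \<le> r \<and> r \<le> p \<and> a < d r"
  by (auto simp: levels_def)

lemma finite_blocks [simp]: "finite (blocks d p)" and finite_levels [simp]: "finite (levels d p)"
  by (auto simp: blocks_def levels_def)

lemma card_blocks: "card (blocks d p) = n_min d p"
  by (simp add: blocks_def n_min_def)

lemma card_levels: "card (levels d p) = (\<Sum>i = 1..p. d i)"
  by (simp add: levels_def)

lemma at_zero_blocks [simp]: "y \<in> levels d p \<Longrightarrow> at_zero y \<in> blocks d p"
  by (cases y) auto

lemma inj_at_zero: "inj_on at_zero A"
  by (rule inj_onI) auto

section \<open>Order and range of the positions\<close>

lemma sum_levels_le:
  assumes "r' < r" "r \<le> p"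
  shows "(\<Sum>i = Suc r..p. f i) + f r \<le> (\<Sum>i = Suc r'..p. (f i :: nat))"
proof -
  have "(\<Sum>i = Suc r..p. f i) + f r = (\<Sum>i = r..p. f i)"
    using assms by (simp add: sum.atLeast_Suc_atMost)
  also have "\<dots> \<le> (\<Sum>i = Suc r'..p. f i)"
    using assms by (intro sum_mono2) auto
  finally show ?thesis .
qed

lemma mult_add_less:
  assumes "a < e" "i < n"
  shows "i * e + a < n * (e :: nat)"
proof -
  have "i * e + a < Suc i * e" using assms by simp
  also have "\<dots> \<le> n * e" using assms by (intro mult_le_mono1) simp
  finally show ?thesis .
qed

text \<open>Level \<open>r\<close> fills \<open>r * d r\<close> consecutive positions, and the
  offset \<open>(r - 1 - j) * d r + a\<close> stays inside them. Levels and the indices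
  \<open>j\<close> are listed in descending order, whence the reversed inequalities.\<close>

lemma block_pos_less:
  assumes "(r, j, a) \<in> blocks d p" "(r', j', a') \<in> blocks d p"
    and "r' < r \<or> r = r' \<and> (j' < j \<or> j = j' \<and> a < a')"
  shows "block_pos d p (r, j, a) < block_pos d p (r', j', a')"
proof (cases "r' < r")
  case True
  have "(r - 1 - j) * d r + a < r * d r"
    using assms by (intro mult_add_less) auto
  moreover have "(\<Sum>i = Suc r..p. i * d i) + r * d r \<le> (\<Sum>i = Suc r'..p. i * d i)"
    using True assms by (intro sum_levels_le) auto
  ultimately show ?thesis
    by (simp add: block_start_def)
next
  case False
  then have r: "r = r'" using assms by auto
  show ?thesis
  proof (cases "j = j'")
    case True
    then show ?thesis using r assms False by simp
  next
    case neq: False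
    have "(r - 1 - j) * d r + a < (r - 1 - j') * d r"
      using assms neq r False by (intro mult_add_less) auto
    then show ?thesis using r by (simp add: block_start_def)
  qed
qed

lemma level_pos_less:
  assumes "(r, a) \<in> levels d p" "(r', a') \<in> levels d p" and "r' < r \<or> r = r' \<and> a < a'"
  shows "level_pos d p (r, a) < level_pos d p (r', a')"
proof (cases "r' < r")
  case True
  have "(\<Sum>i = Suc r..p. d i) + d r \<le> (\<Sum>i = Suc r'..p. d i)"
    using True assms by (intro sum_levels_le) auto
  then show ?thesis using assms by simp
qed (use assms in auto)

lemma inj_block_pos: "inj_on (block_pos d p) (blocks d p)"
proof (rule inj_onI)
  fix x y assume xy: "x \<in> blocks d p" "y \<in> blocks d p" "block_pos d p x = block_pos d p y"
  obtain r j a where x: "x = (r, j, a)" by (cases x)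
  obtain r' j' a' where y: "y = (r', j', a')" by (cases y)
  show "x = y"
    using block_pos_less[of r j a d p r' j' a'] block_pos_less[of r' j' a' d p r j a] xy
    unfolding x y by (cases r r' rule: linorder_cases; cases j j' rule: linorder_cases;
        cases a a' rule: linorder_cases) auto
qed

lemma inj_level_pos: "inj_on (level_pos d p) (levels d p)"
proof (rule inj_onI)
  fix x y assume xy: "x \<in> levels d p" "y \<in> levels d p" "level_pos d p x = level_pos d p y"
  obtain r a where x: "x = (r, a)" by (cases x)
  obtain r' a' where y: "y = (r', a')" by (cases y)
  show "x = y"
    using level_pos_less[of r a d p r' a'] level_pos_less[of r' a' d p r a] xy
    unfolding x y by (cases r r' rule: linorder_cases; cases a a' rule: linorder_cases) auto
qed

lemma block_pos_lt_n_min: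
  assumes "x \<in> blocks d p"
  shows "block_pos d p x < n_min d p"
proof -
  obtain r j a where x: "x = (r, j, a)" by (cases x)
  have "(r - 1 - j) * d r + a < r * d r"
    using assms unfolding x by (intro mult_add_less) auto
  moreover have "(\<Sum>i = Suc r..p. i * d i) + r * d r \<le> (\<Sum>i = Suc 0..p. i * d i)"
    using assms unfolding x by (intro sum_levels_le) auto
  ultimately show ?thesis
    by (simp add: block_start_def x n_min_def)
qed

lemma level_pos_lt_sum:
  assumes "x \<in> levels d p"
  shows "level_pos d p x < (\<Sum>i = 1..p. d i)"
proof -
  obtain r a where x: "x = (r, a)" by (cases x)
  have "(\<Sum>i = Suc r..p. d i) + d r \<le> (\<Sum>i = Suc 0..p. d i)"
    using assms unfolding x by (intro sum_levels_le) auto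
  then show ?thesis using assms by (simp add: x)
qed

text \<open>An injection into an interval with as many elements as its domain is onto. This turns
  sums over matrix indices into sums over labels.\<close>

lemma bij_block_pos: "bij_betw (block_pos d p) (blocks d p) {..<n_min d p}"
proof -
  have "block_pos d p ` blocks d p = {..<n_min d p}"
    using block_pos_lt_n_min by (intro card_subset_eq) (auto simp: inj_block_pos card_image card_blocks
        simp del: block_pos.simps)
  then show ?thesis by (simp add: bij_betw_def inj_block_pos)
qed

lemma bij_level_pos: "bij_betw (level_pos d p) (levels d p) {..<\<Sum>i = 1..p. d i}"
proof -
  have "level_pos d p ` levels d p \<subseteq> {..<\<Sum>i = 1..p. d i}"
    using level_pos_lt_sum by blast
  then have "level_pos d p ` levels d p = {..<\<Sum>i = 1..p. d i}"
    by (intro card_subset_eq) (simp_all add: inj_level_pos card_image card_levels)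
  then show ?thesis by (simp add: bij_betw_def inj_level_pos)
qed

lemma block_pos_cases:
  assumes "i < n_min d p"
  obtains x where "x \<in> blocks d p" "i = block_pos d p x"
  using bij_block_pos[of d p] assms unfolding bij_betw_def by blast

lemma level_pos_cases:
  assumes "i < (\<Sum>i = 1..p. d i)"
  obtains x where "x \<in> levels d p" "i = level_pos d p x"
  using bij_level_pos[of d p] assms unfolding bij_betw_def by blast

lemma all_level_pos: "(\<forall>i<\<Sum>i = 1..p. d i. P i) \<longleftrightarrow> (\<forall>x\<in>levels d p. P (level_pos d p x))"
proof -
  have "(\<forall>i<\<Sum>i = 1..p. d i. P i) \<longleftrightarrow> (\<forall>i\<in>{..<\<Sum>i = 1..p. d i}. P i)" by blast
  also have "{..<\<Sum>i = 1..p. d i} = level_pos d p ` levels d p"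
    by (rule bij_betw_imp_surj_on[OF bij_level_pos, symmetric])
  finally show ?thesis by (simp only: ball_simps)
qed

lemma sum_block_pos: "(\<Sum>i<n_min d p. f i) = (\<Sum>x\<in>blocks d p. f (block_pos d p x))"
  by (rule sum.reindex_bij_betw[OF bij_block_pos, symmetric])

lemma sum_level_pos: "(\<Sum>i<\<Sum>i = 1..p. d i. f i) = (\<Sum>x\<in>levels d p. f (level_pos d p x))"
  by (rule sum.reindex_bij_betw[OF bij_level_pos, symmetric])

section \<open>Extraction of rows and blocks in terms of labels\<close>

lemma zero_idx_eq: "zero_idx d p = (block_pos d p \<circ> at_zero) ` levels d p"
proof (intro equalityI subsetI)
  fix i assume "i \<in> zero_idx d p"
  then obtain r where r: "r \<in> {1..p}" "i \<in> block_idx d p r 0" by (auto simp: zero_idx_def)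
  then have "i = (block_pos d p \<circ> at_zero) (r, i - block_start d p r 0)" 
    "(r, i - block_start d p r 0) \<in> levels d p" by (auto simp: block_idx_def)
  then show "i \<in> (block_pos d p \<circ> at_zero) ` levels d p" by blast
next
  fix i assume "i \<in> (block_pos d p \<circ> at_zero) ` levels d p"
  then obtain r a where "(r, a) \<in> levels d p" "i = block_start d p r 0 + a" by auto
  then show "i \<in> zero_idx d p" unfolding zero_idx_def block_idx_def by force
qed

text \<open>Since \<open>submatrix\<close> lists the selected rows in increasing order, a row of the
  stack is found by counting the selected positions before it. For this both numberings must order
  the labels alike.\<close>

lemma block_pos_at_zero_less_iff:
  assumes "x \<in> levels d p" "y \<in> levels d p"
  shows "block_pos d p (at_zero x) < block_pos d p (at_zero y) \<longleftrightarrow> level_pos d p x < level_pos d p y"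
proof -
  obtain r a where x: "x = (r, a)" by (cases x)
  obtain r' a' where y: "y = (r', a')" by (cases y)
  consider "r' < r \<or> r = r' \<and> a < a'" | "r < r' \<or> r' = r \<and> a' < a" | "r = r'" "a = a'"
    by linarith
  then show ?thesis
  proof cases
    case 1
    then show ?thesis
      using level_pos_less[of r a d p r' a'] block_pos_less[of r 0 a d p r' 0 a'] assms
      by (simp add: x y del: level_pos.simps block_pos.simps)
  next
    case 2
    then have "level_pos d p y < level_pos d p x" "block_pos d p (at_zero y) < block_pos d p (at_zero x)"
      using level_pos_less[of r' a' d p r a] block_pos_less[of r' 0 a' d p r 0 a] assms
      by (simp_all add: x y del: level_pos.simps block_pos.simps)
    then show ?thesis by simp
  qed (simp add: x y)
qed

text \<open>The selected positions below correspond to the labels of smaller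
  \<open>level_pos\<close>, and \<open>level_pos\<close> maps these onto an initial interval. This
  count is what determines \<open>pick\<close> on \<open>zero_idx d p\<close>.\<close>

lemma card_zero_idx_less:
  assumes "y \<in> levels d p"
  shows "card {i \<in> zero_idx d p. i < block_pos d p (at_zero y)} = level_pos d p y"
proof -
  have inj: "inj_on (block_pos d p \<circ> at_zero) (levels d p)"
    by (intro comp_inj_on inj_at_zero inj_on_subset[OF inj_block_pos]) auto
  have "{i \<in> zero_idx d p. i < block_pos d p (at_zero y)}
      = (block_pos d p \<circ> at_zero) ` {x \<in> levels d p. level_pos d p x < level_pos d p y}"
    unfolding zero_idx_eq using block_pos_at_zero_less_iff[OF _ assms] by force
  then have "card {i \<in> zero_idx d p. i < block_pos d p (at_zero y)}
      = card {x \<in> levels d p. level_pos d p x < level_pos d p y}"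
    using card_image[OF inj_on_subset[OF inj,
        of "{x \<in> levels d p. level_pos d p x < level_pos d p y}"]] by simp
  also have "\<dots> = card (level_pos d p ` {x \<in> levels d p. level_pos d p x < level_pos d p y})"
    by (intro card_image[symmetric] inj_on_subset[OF inj_level_pos]) auto
  also have "level_pos d p ` {x \<in> levels d p. level_pos d p x < level_pos d p y}
      = {..<level_pos d p y}"
  proof (intro equalityI subsetI)
    fix i assume i: "i \<in> {..<level_pos d p y}"
    then have "i < (\<Sum>i = 1..p. d i)" using level_pos_lt_sum[OF assms] by simp
    then obtain x where "x \<in> levels d p" "i = level_pos d p x" by (rule level_pos_cases)
    then show "i \<in> level_pos d p ` {x \<in> levels d p. level_pos d p x < level_pos d p y}"
        using i by blast
  qed auto
  finally show ?thesis by simp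
qed

lemma card_zero_idx: "card {i. i < n_min d p \<and> i \<in> zero_idx d p} = (\<Sum>i = 1..p. d i)"
proof -
  have "{i. i < n_min d p \<and> i \<in> zero_idx d p} = (block_pos d p \<circ> at_zero) ` levels d p"
    using block_pos_lt_n_min by (auto simp: zero_idx_eq simp del: block_pos.simps)
  moreover have "inj_on (block_pos d p \<circ> at_zero) (levels d p)"
    by (intro comp_inj_on inj_at_zero inj_on_subset[OF inj_block_pos]) auto
  ultimately show ?thesis by (simp only: card_image card_levels)
qed

lemma pick_zero_idx: "y \<in> levels d p \<Longrightarrow> pick (zero_idx d p) (level_pos d p y)
    = block_pos d p (at_zero y)"
  using pick_card_in_set[of "block_pos d p (at_zero y)" "zero_idx d p"]
  by (simp only: card_zero_idx_less) (auto simp: zero_idx_eq)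

lemma rows_zero_carrier:
  assumes "G \<in> carrier_mat (n_min d p) m"
  shows "rows_zero d p G \<in> carrier_mat (\<Sum>i = 1..p. d i) m"
  unfolding rows_zero_def
  by (rule carrier_matI) (simp_all only: dim_submatrix carrier_matD[OF assms] card_zero_idx, simp)

lemma zero_part_carrier:
  assumes "S \<in> carrier_mat (n_min d p) (n_min d p)"
  shows "zero_part d p S \<in> carrier_mat (\<Sum>i = 1..p. d i) (\<Sum>i = 1..p. d i)"
  unfolding zero_part_def
  by (rule carrier_matI) (simp_all only: dim_submatrix carrier_matD[OF assms] card_zero_idx)

lemma rows_zero_index:
  assumes "G \<in> carrier_mat (n_min d p) m" "y \<in> levels d p" "c < m"
  shows "rows_zero d p G $$ (level_pos d p y, c) = G $$ (block_pos d p (at_zero y), c)"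
proof -
  have "level_pos d p y < card {i. i < dim_row G \<and> i \<in> zero_idx d p}"
    "c < card {i. i < dim_col G \<and> i \<in> UNIV}"
    unfolding carrier_matD[OF assms(1)] card_zero_idx
    using assms(3) level_pos_lt_sum[OF assms(2)] by simp_all
  then show ?thesis
    unfolding rows_zero_def by (simp only: submatrix_index pick_zero_idx[OF assms(2)] pick_UNIV)
qed

lemma zero_part_index:
  assumes "S \<in> carrier_mat (n_min d p) (n_min d p)" "x \<in> levels d p" "y \<in> levels d p"
  shows "zero_part d p S $$ (level_pos d p x, level_pos d p y)
      = S $$ (block_pos d p (at_zero x), block_pos d p (at_zero y))"
proof -
  have "level_pos d p x < card {i. i < dim_row S \<and> i \<in> zero_idx d p}"
    "level_pos d p y < card {i. i < dim_col S \<and> i \<in> zero_idx d p}"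
    unfolding carrier_matD[OF assms(1)] card_zero_idx
    by (rule level_pos_lt_sum[OF assms(2)] level_pos_lt_sum[OF assms(3)])+
  then show ?thesis
    unfolding zero_part_def by (simp only: submatrix_index pick_zero_idx assms(2,3))
qed

lemma pick_atLeastLessThan:
  assumes "a < n"
  shows "pick {s..<s + n} a = s + a"
proof -
  have "{b \<in> {s..<s + n}. b < s + a} = {s..<s + a}" using assms by auto
  then show ?thesis using pick_card_in_set[of "s + a" "{s..<s + n}"] assms by simp
qed

lemma card_below_interval: "s + e \<le> n \<Longrightarrow> card {i. i < n \<and> i \<in> {s..<s + e}} = (e :: nat)"
proof -
  assume "s + e \<le> n"
  then have "{i. i < n \<and> i \<in> {s..<s + e}} = {s..<s + e}" by auto
  then show ?thesis by simp
qed

lemma block_end_le_n_min: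
  assumes "r \<in> {1..p}" "j < r"
  shows "block_start d p r j + d r \<le> n_min d p"
proof (cases "d r = 0")
  \<comment> \<open>An empty block contains no label whose position could be bounded; its start is
    the total size of the levels above \<open>r\<close>.\<close>
  case True
  have "(\<Sum>i = Suc r..p. i * d i) + r * d r \<le> (\<Sum>i = Suc 0..p. i * d i)"
    using assms by (intro sum_levels_le) auto
  then show ?thesis using True by (simp add: block_start_def n_min_def)
next
  case False
  then show ?thesis
    using block_pos_lt_n_min[of "(r, j, d r - 1)" d p] assms by simp
qed

lemma level_end_le:
  fixes d :: "nat \<Rightarrow> nat"
  assumes "r \<in> {1..p}"
  shows "(\<Sum>r' = Suc r..p. d r') + d r \<le> (\<Sum>i = 1..p. d i)"
  using sum_levels_le[of 0 r p d] assms by simp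

lemma card_level_idx:
  assumes "r \<in> {1..p}"
  shows "card {i. i < (\<Sum>i = 1..p. d i) \<and> i \<in> level_idx d p r} = d r"
  unfolding level_idx_def by (rule card_below_interval[OF level_end_le[OF assms]])

lemma row_block_carrier [simp]:
  assumes "G \<in> carrier_mat (n_min d p) m" "r \<in> {1..p}" "j < r"
  shows "row_block d p G r j \<in> carrier_mat (d r) m"
  unfolding row_block_def block_idx_def
  by (rule carrier_matI) (simp_all only: dim_submatrix carrier_matD[OF assms(1)]
      card_below_interval[OF block_end_le_n_min[OF assms(2,3)]], simp)

lemma row_block_index:
  assumes "G \<in> carrier_mat (n_min d p) m" "(r, j, a) \<in> blocks d p" "c < m"
  shows "row_block d p G r j $$ (a, c) = G $$ (block_pos d p (r, j, a), c)"
proof -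
  have r: "r \<in> {1..p}" "j < r" "a < d r" using assms(2) by auto
  have "a < card {i. i < dim_row G \<and> i \<in> block_idx d p r j}"
    "c < card {i. i < dim_col G \<and> i \<in> UNIV}"
    unfolding carrier_matD[OF assms(1)] block_idx_def
      card_below_interval[OF block_end_le_n_min[OF r(1,2)]]
    using assms(3) r(3) by simp_all
  then show ?thesis
    unfolding row_block_def
    by (simp only: submatrix_index block_idx_def pick_atLeastLessThan[OF r(3)] pick_UNIV block_pos.simps)
qed

lemma block_lower_triangular_iff:
  assumes "L \<in> carrier_mat (\<Sum>i = 1..p. d i) (\<Sum>i = 1..p. d i)"
  shows "block_lower_triangular d p L \<longleftrightarrow>
    (\<forall>x\<in>levels d p. \<forall>y\<in>levels d p. fst x > fst y \<longrightarrow> L $$ (level_pos d p x, level_pos d p y) = 0)"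
proof -
  have sub: "submatrix L (level_idx d p r) (level_idx d p r') \<in> carrier_mat (d r) (d r')"
    if "r \<in> {1..p}" "r' \<in> {1..p}" for r r'
    by (rule carrier_matI)
      (simp_all only: dim_submatrix carrier_matD[OF assms] card_level_idx that)
  have idx: "submatrix L (level_idx d p r) (level_idx d p r') $$ (a, a')
      = L $$ (level_pos d p (r, a), level_pos d p (r', a'))"
    if "(r, a) \<in> levels d p" "(r', a') \<in> levels d p" for r r' a a'
  proof -
    have "a < card {i. i < dim_row L \<and> i \<in> level_idx d p r}"
      "a' < card {i. i < dim_col L \<and> i \<in> level_idx d p r'}"
      unfolding carrier_matD[OF assms] using that card_level_idx[of r p d] card_level_idx[of r' p d]
      by simp_all
    then have "submatrix L (level_idx d p r) (level_idx d p r') $$ (a, a')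
        = L $$ (pick (level_idx d p r) a, pick (level_idx d p r') a')"
      by (rule submatrix_index)
    then show ?thesis
      using that by (simp add: level_idx_def pick_atLeastLessThan)
  qed
  have "block_lower_triangular d p L \<longleftrightarrow>
    (\<forall>r\<in>{1..p}. \<forall>r'\<in>{1..p}. r > r' \<longrightarrow> (\<forall>a<d r. \<forall>a'<d r'.
      submatrix L (level_idx d p r) (level_idx d p r') $$ (a, a') = 0))"
    unfolding block_lower_triangular_def
    by (intro ball_cong refl imp_cong) (simp add: mat_eq_iff carrier_matD[OF sub])
  also have "\<dots> \<longleftrightarrow> (\<forall>x\<in>levels d p. \<forall>y\<in>levels d p. fst x > fst y \<longrightarrow>
      L $$ (level_pos d p x, level_pos d p y) = 0)"
    using idx by (auto simp: levels_def simp del: level_pos.simps)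
  finally show ?thesis .
qed

section \<open>Matrix products as sums, and condition (ii) entrywise\<close>

lemma mult_transpose_eq_sum:
  assumes "A \<in> carrier_mat n m" "B \<in> carrier_mat n' m" "i < n" "k < n'"
  shows "(A * transpose_mat B) $$ (i, k) = (\<Sum>c<m. A $$ (i, c) * B $$ (k, c))"
  using assms by (simp add: scalar_prod_def atLeast0LessThan)

lemma mult_mat_eq_sum:
  assumes "A \<in> carrier_mat n m" "B \<in> carrier_mat m n'" "i < n" "k < n'"
  shows "(A * B) $$ (i, k) = (\<Sum>c<m. A $$ (i, c) * B $$ (c, k))"
  using assms by (simp add: scalar_prod_def atLeast0LessThan)

text \<open>For natural numbers the bound on \<open>l\<close> splits into \<open>1 \<le> l\<close>
  and \<open>r \<le> l + r'\<close>. The second inequality is also the one under which the block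
  \<open>(r, l; r', 0)\<close> of a matrix commuting with \<open>F\<close> may be nonzero, so every
  row of unknowns meets as many equations as it has entries.\<close>

lemma cond_ii_iff:
  assumes G: "G \<in> carrier_mat (n_min d p) m"
  shows "cond_ii d p G \<longleftrightarrow> (\<forall>r l a r' b. (r, l, a) \<in> blocks d p \<longrightarrow> (r', b) \<in> levels d p
    \<longrightarrow> 1 \<le> l \<longrightarrow> r \<le> l + r'
    \<longrightarrow> (\<Sum>c<m. G $$ (block_pos d p (r, l, a), c) * G $$ (block_pos d p (at_zero (r', b)), c)) = 0)"
    (is "_ \<longleftrightarrow> ?R")
proof -
  have *: "row_block d p G r l * transpose_mat (row_block d p G r' 0) = 0\<^sub>m (d r) (d r') \<longleftrightarrow>
    (\<forall>a<d r. \<forall>b<d r'. (\<Sum>c<m. G $$ (block_pos d p (r, l, a), c) * G $$ (block_pos d p (r', 0, b), c))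
        = 0)"
    (is "?A * ?B = _ \<longleftrightarrow> _")
    if "r \<in> {1..p}" "l < r" "r' \<in> {1..p}" for r l r'
  proof -
    have A: "?A \<in> carrier_mat (d r) m" and B: "row_block d p G r' 0 \<in> carrier_mat (d r') m"
      using that G by auto
    have "?A * ?B = 0\<^sub>m (d r) (d r') \<longleftrightarrow> (\<forall>a<d r. \<forall>b<d r'. (?A * ?B) $$ (a, b) = 0)"
      using A B by (auto simp: mat_eq_iff)
    also have "\<dots> \<longleftrightarrow> (\<forall>a<d r. \<forall>b<d r'.
        (\<Sum>c<m. ?A $$ (a, c) * row_block d p G r' 0 $$ (b, c)) = 0)"
      using mult_transpose_eq_sum[OF A B] by auto
    also have "\<dots> \<longleftrightarrow> (\<forall>a<d r. \<forall>b<d r'.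
        (\<Sum>c<m. G $$ (block_pos d p (r, l, a), c) * G $$ (block_pos d p (r', 0, b), c)) = 0)"
      using that by (simp add: row_block_index[OF G] del: block_pos.simps)
    finally show ?thesis .
  qed
  have "cond_ii d p G \<longleftrightarrow> (\<forall>r\<in>{1..p}. \<forall>r'\<in>{1..p}. \<forall>l. l < r \<and> 1 \<le> l \<and> r \<le> l + r' \<longrightarrow>
     (\<forall>a<d r. \<forall>b<d r'. (\<Sum>c<m. G $$ (block_pos d p (r, l, a), c)
         * G $$ (block_pos d p (r', 0, b), c)) = 0))"
    unfolding cond_ii_def
  proof (intro ball_cong refl all_cong1)
    fix r r' l assume r: "r \<in> {1..p}" "r' \<in> {1..p}"
    have "l \<le> r - 1 \<and> int l > max 0 (int r - int r' - 1) \<longleftrightarrow> l < r \<and> 1 \<le> l \<and> r \<le> l + r'"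
      using r by auto
    then show "(l \<le> r - 1 \<and> int l > max 0 (int r - int r' - 1) \<longrightarrow>
        row_block d p G r l * transpose_mat (row_block d p G r' 0) = 0\<^sub>m (d r) (d r')) \<longleftrightarrow>
       (l < r \<and> 1 \<le> l \<and> r \<le> l + r' \<longrightarrow>
     (\<forall>a<d r. \<forall>b<d r'. (\<Sum>c<m. G $$ (block_pos d p (r, l, a), c)
         * G $$ (block_pos d p (r', 0, b), c)) = 0))"
      using * r by blast
  qed
  also have "\<dots> \<longleftrightarrow> ?R" by (auto simp del: block_pos.simps)
  finally show ?thesis .
qed

subsection \<open>Triangular systems and orthonormalization\<close>

text \<open>A one-sided inverse of a square matrix is two-sided; an enumeration of \<open>X\<close>
  carries this over to families indexed by labels.\<close>

lemma finite_left_right_inverse: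
  fixes A B :: "'a \<Rightarrow> 'a \<Rightarrow> real"
  assumes "finite X"
    and AB: "\<And>x z. x \<in> X \<Longrightarrow> z \<in> X \<Longrightarrow> (\<Sum>y\<in>X. A x y * B y z) = (if x = z then 1 else 0)"
    and xz: "x \<in> X" "z \<in> X"
  shows "(\<Sum>y\<in>X. B x y * A y z) = (if x = z then 1 else 0)"
proof -
  let ?n = "card X"
  obtain h where h: "bij_betw h {0..<?n} X"
    using ex_bij_betw_nat_finite[OF \<open>finite X\<close>] by blast
  have hX: "h i \<in> X" if "i < ?n" for i using h that by (auto simp: bij_betw_def)
  have heq: "h i = h k \<longleftrightarrow> i = k" if "i < ?n" "k < ?n" for i k
    using h that by (auto simp: bij_betw_def inj_on_eq_iff)
  define P where "P = mat ?n ?n (\<lambda>(i, k). A (h i) (h k))"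
  define Q where "Q = mat ?n ?n (\<lambda>(i, k). B (h i) (h k))"
  have PQ: "P \<in> carrier_mat ?n ?n" "Q \<in> carrier_mat ?n ?n" by (auto simp: P_def Q_def)
  have "P * Q = 1\<^sub>m ?n"
  proof (rule eq_matI)
    fix i k assume ik: "i < dim_row (1\<^sub>m ?n :: real mat)" "k < dim_col (1\<^sub>m ?n :: real mat)"
    have "(P * Q) $$ (i, k) = (\<Sum>j = 0..<?n. A (h i) (h j) * B (h j) (h k))"
      using ik by (simp add: P_def Q_def scalar_prod_def)
    also have "\<dots> = (\<Sum>y\<in>X. A (h i) y * B y (h k))"
      by (rule sum.reindex_bij_betw[OF h])
    finally show "(P * Q) $$ (i, k) = 1\<^sub>m ?n $$ (i, k)"
      using ik by (simp add: AB hX heq)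
  qed (use PQ in auto)
  then have QP: "Q * P = 1\<^sub>m ?n"
    using mat_mult_left_right_inverse PQ by blast
  have "x \<in> h ` {0..<?n}" "z \<in> h ` {0..<?n}"
    using xz by (simp_all add: bij_betw_imp_surj_on[OF h])
  then obtain i k where ik: "i < ?n" "k < ?n" "x = h i" "z = h k"
    by auto
  have "(Q * P) $$ (i, k) = (\<Sum>j = 0..<?n. B (h i) (h j) * A (h j) (h k))"
    using ik by (simp add: P_def Q_def scalar_prod_def)
  also have "\<dots> = (\<Sum>y\<in>X. B (h i) y * A y (h k))"
    by (rule sum.reindex_bij_betw[OF h])
  finally show ?thesis
    using ik by (simp add: QP heq)
qed

text \<open>If \<open>c \<le> h x\<close>, the terms with \<open>h y < c\<close> vanish because then
  \<open>h y < h x\<close>. So the truncation of \<open>M\<close> is still a right inverse of the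
  truncation of \<open>L\<close>.\<close>

lemma triangular_minor_inverse:
  fixes L M :: "'a \<Rightarrow> 'a \<Rightarrow> real" and h :: "'a \<Rightarrow> nat"
  assumes "finite Z"
    and tri: "\<And>x y. x \<in> Z \<Longrightarrow> y \<in> Z \<Longrightarrow> h y < h x \<Longrightarrow> L x y = 0"
    and LM: "\<And>x z. x \<in> Z \<Longrightarrow> z \<in> Z \<Longrightarrow> (\<Sum>y\<in>Z. L x y * M y z) = (if x = z then 1 else 0)"
    and xz: "x \<in> {x\<in>Z. c \<le> h x}" "z \<in> {x\<in>Z. c \<le> h x}"
  shows "(\<Sum>y\<in>{x\<in>Z. c \<le> h x}. L x y * M y z) = (if x = z then 1 else 0)"
proof -
  have "(\<Sum>y\<in>{x\<in>Z. c \<le> h x}. L x y * M y z) = (\<Sum>y\<in>Z. L x y * M y z)"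
  proof (intro sum.mono_neutral_left ballI)
    fix y assume "y \<in> Z - {x\<in>Z. c \<le> h x}"
    then have "L x y = 0" using xz by (intro tri) auto
    then show "L x y * M y z = 0" by simp
  qed (use \<open>finite Z\<close> in auto)
  then show ?thesis using LM xz by simp
qed

text \<open>After truncation \<open>L\<close> and \<open>M\<close> are mutually inverse, so
  multiplication by \<open>L\<close> solves the row system \<open>u M = e\<close>, and
  multiplication by \<open>M\<close> leads back. The equivalence serves both existence and
  uniqueness.\<close>

lemma triangular_minor_solve:
  fixes L M :: "'a \<Rightarrow> 'a \<Rightarrow> real" and h :: "'a \<Rightarrow> nat" and c :: nat and u e :: "'a \<Rightarrow> real"
  defines "X \<equiv> \<lambda>Z. {x\<in>Z. c \<le> h x}"
  assumes "finite Z"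
    and tri: "\<And>x y. x \<in> Z \<Longrightarrow> y \<in> Z \<Longrightarrow> h y < h x \<Longrightarrow> L x y = 0"
    and LM: "\<And>x z. x \<in> Z \<Longrightarrow> z \<in> Z \<Longrightarrow> (\<Sum>y\<in>Z. L x y * M y z) = (if x = z then 1 else 0)"
  shows "(\<forall>z\<in>X Z. (\<Sum>y\<in>X Z. u y * M y z) = e z) \<longleftrightarrow> (\<forall>y\<in>X Z. u y = (\<Sum>z\<in>X Z. e z * L z y))"
proof -
  have fin: "finite (X Z)" using \<open>finite Z\<close> by (simp add: X_def)
  have lm: "(\<Sum>y\<in>X Z. L x y * M y z) = (if x = z then 1 else 0)" if "x \<in> X Z" "z \<in> X Z" for x z
    using triangular_minor_inverse[OF assms(2) tri LM] that unfolding X_def by blast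
  have ml: "(\<Sum>y\<in>X Z. M x y * L y z) = (if x = z then 1 else 0)" if "x \<in> X Z" "z \<in> X Z" for x z
    by (rule finite_left_right_inverse[OF fin lm that])
  \<comment> \<open>Associativity, \<open>(v A) B = v (A B) = v\<close>; it is applied to
    \<open>M\<close>, \<open>L\<close> and to \<open>L\<close>, \<open>M\<close>.\<close>
  have comp: "(\<Sum>z\<in>X Z. (\<Sum>x\<in>X Z. v x * A x z) * B z y) = v y"
    if "y \<in> X Z" "\<And>x z. x \<in> X Z \<Longrightarrow> z \<in> X Z \<Longrightarrow> (\<Sum>y\<in>X Z. A x y * B y z) = (if x = z then 1 else 0)"
    for A B :: "'a \<Rightarrow> 'a \<Rightarrow> real" and v y
  proof -
    have "(\<Sum>z\<in>X Z. (\<Sum>x\<in>X Z. v x * A x z) * B z y) = (\<Sum>x\<in>X Z. v x * (\<Sum>z\<in>X Z. A x z * B z y))"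
      unfolding sum_distrib_left sum_distrib_right
      by (subst sum.swap) (simp add: mult.assoc)
    also have "\<dots> = (\<Sum>x\<in>X Z. if x = y then v x else 0)"
      using that by (intro sum.cong) auto
    also have "\<dots> = v y" using fin that(1) by simp
    finally show ?thesis .
  qed
  show ?thesis
  proof (intro iffI ballI)
    fix y assume e: "\<forall>z\<in>X Z. (\<Sum>y\<in>X Z. u y * M y z) = e z" and y: "y \<in> X Z"
    have "(\<Sum>z\<in>X Z. e z * L z y) = (\<Sum>z\<in>X Z. (\<Sum>x\<in>X Z. u x * M x z) * L z y)"
      using e by (intro sum.cong) auto
    also have "\<dots> = u y" by (rule comp[OF y ml])
    finally show "u y = (\<Sum>z\<in>X Z. e z * L z y)" by simp
  next
    fix z assume u: "\<forall>y\<in>X Z. u y = (\<Sum>z\<in>X Z. e z * L z y)" and z: "z \<in> X Z"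
    have "(\<Sum>y\<in>X Z. u y * M y z) = (\<Sum>y\<in>X Z. (\<Sum>x\<in>X Z. e x * L x y) * M y z)"
      using u by (intro sum.cong) auto
    also have "\<dots> = e z" by (rule comp[OF z lm])
    finally show "(\<Sum>y\<in>X Z. u y * M y z) = e z" .
  qed
qed

text \<open>Gram-Schmidt by induction on the number of vectors; the hypothesis is their linear
  independence. Triangularity is stated for all indices, so that the rows already found have
  coefficient 0 at the next vector.\<close>

lemma triangular_orthonormalization:
  fixes w :: "nat \<Rightarrow> nat \<Rightarrow> real"
  assumes "\<And>c. (\<And>t. t < m \<Longrightarrow> (\<Sum>i<n. c i * w i t) = 0) \<Longrightarrow> \<forall>i<n. c i = 0"
  shows "\<exists>L. (\<forall>i j. i < j \<longrightarrow> L i j = 0) \<and> (\<forall>i<n. \<forall>k<n.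
    (\<Sum>t<m. (\<Sum>j<n. L i j * w j t) * (\<Sum>j<n. L k j * w j t)) = (if i = k then 1 else 0))"
  using assms
proof (induction n)
  case 0
  show ?case by (rule exI[of _ "\<lambda>_ _. 0"]) simp
next
  case (Suc n)
  \<comment> \<open>The coefficient 0 at \<open>w n\<close> extends a relation among the first
    \<open>n\<close> vectors.\<close>
  have indep: "\<forall>i<n. c i = 0" if "\<And>t. t < m \<Longrightarrow> (\<Sum>i<n. c i * w i t) = 0" for c
    using Suc.prems[of "c(n := 0)"] that by (auto simp: less_Suc_eq)
  obtain L where tri: "\<And>i j. i < j \<Longrightarrow> L i j = 0"
    and on: "\<And>i k. i < n \<Longrightarrow> k < n \<Longrightarrow>
      (\<Sum>t<m. (\<Sum>j<n. L i j * w j t) * (\<Sum>j<n. L k j * w j t)) = (if i = k then 1 else 0)"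
    using Suc.IH[OF indep] by blast
  \<comment> \<open>\<open>q\<close> are the orthonormal vectors found so far, \<open>a\<close> the
    components of \<open>w n\<close> along them, \<open>x\<close> the residual and \<open>c\<close>
    its coefficients in terms of the \<open>w j\<close>.\<close>
  define q where "q i t = (\<Sum>j<n. L i j * w j t)" for i t
  define a where "a i = (\<Sum>t<m. w n t * q i t)" for i
  define x where "x t = w n t - (\<Sum>i<n. a i * q i t)" for t
  define c where "c j = (if j = n then 1 else - (\<Sum>i<n. a i * L i j))" for j
  define N where "N = (\<Sum>t<m. x t * x t)"
  have on': "(\<Sum>t<m. q i t * q k t) = (if i = k then 1 else 0)" if "i < n" "k < n" for i k
    using on[OF that] by (simp add: q_def)
  have x_c: "x t = (\<Sum>j<Suc n. c j * w j t)" for t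
  proof -
    have "(\<Sum>i<n. a i * q i t) = (\<Sum>j<n. (\<Sum>i<n. a i * L i j) * w j t)"
      unfolding q_def sum_distrib_left sum_distrib_right
      by (subst sum.swap) (simp add: mult.assoc)
    then show ?thesis by (simp add: x_def c_def sum_negf)
  qed
  have ortho: "(\<Sum>t<m. x t * q k t) = 0" if "k < n" for k
  proof -
    have "(\<Sum>t<m. (\<Sum>i<n. a i * q i t) * q k t) = (\<Sum>i<n. a i * (\<Sum>t<m. q i t * q k t))"
      unfolding sum_distrib_left sum_distrib_right
      by (subst sum.swap) (simp add: mult.assoc)
    also have "\<dots> = (\<Sum>i<n. if i = k then a i else 0)"
      using that by (intro sum.cong) (auto simp: on')
    also have "\<dots> = a k" using that by simp
    finally show ?thesis
      by (simp add: x_def left_diff_distrib sum_subtractf a_def)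
  qed
  \<comment> \<open>A vanishing residual would be a linear relation in which \<open>w n\<close> has
    coefficient 1.\<close>
  have "N \<noteq> 0"
  proof
    assume "N = 0"
    then have "\<forall>t<m. x t = 0"
      unfolding N_def by (subst (asm) sum_nonneg_eq_0_iff) auto
    then have "\<forall>i<Suc n. c i = 0" by (intro Suc.prems) (simp add: x_c[symmetric]
        del: sum.lessThan_Suc)
    then have "c n = 0" by blast
    then show False by (simp add: c_def)
  qed
  moreover have "N \<ge> 0" unfolding N_def by (intro sum_nonneg) auto
  ultimately have N: "N > 0" by simp
  \<comment> \<open>Only row \<open>n\<close> is new: the normalized residual, filled up with zeros
    beyond \<open>n\<close> to stay triangular.\<close>
  define L' where "L' i j = (if i = n then (if j \<le> n then c j / sqrt N else 0) else L i j)" for i j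
  have q': "(\<Sum>j<Suc n. L' i j * w j t) = (if i = n then x t / sqrt N else q i t)"
      if "i < Suc n" for i t
  proof (cases "i = n")
    case True
    have "(\<Sum>j<Suc n. L' n j * w j t) = (\<Sum>j<Suc n. c j * w j t / sqrt N)"
      by (intro sum.cong) (auto simp: L'_def)
    then show ?thesis using True by (simp add: x_c sum_divide_distrib del: sum.lessThan_Suc)
  next
    case False
    then have "L' i n = 0" using that tri by (simp add: L'_def)
    then show ?thesis using False by (simp add: q_def L'_def)
  qed
  have "\<forall>i<Suc n. \<forall>k<Suc n. (\<Sum>t<m. (\<Sum>j<Suc n. L' i j * w j t) * (\<Sum>j<Suc n. L' k j * w j t))
      = (if i = k then 1 else 0)"
  proof (intro allI impI)
    fix i k assume ik: "i < Suc n" "k < Suc n"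
    have lin: "(\<Sum>t<m. x t / sqrt N * q k t) = 0" "(\<Sum>t<m. q k t * (x t / sqrt N)) = 0"
        if "k < n" for k
      using ortho[OF that] by (simp_all add: sum_divide_distrib[symmetric] mult.commute)
    have "(\<Sum>t<m. x t / sqrt N * (x t / sqrt N)) = N / (sqrt N * sqrt N)"
      by (simp add: N_def sum_divide_distrib)
    then have nn: "(\<Sum>t<m. x t / sqrt N * (x t / sqrt N)) = 1" using N by simp
    show "(\<Sum>t<m. (\<Sum>j<Suc n. L' i j * w j t) * (\<Sum>j<Suc n. L' k j * w j t))
      = (if i = k then 1 else 0)"
      unfolding q'[OF ik(1)] q'[OF ik(2)]
      using ik lin nn on' by (cases "i = n"; cases "k = n") (auto simp: less_Suc_eq)
  qed
  moreover have "\<forall>i j. i < j \<longrightarrow> L' i j = 0" by (auto simp: L'_def tri)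
  ultimately show ?case by blast
qed

text \<open>The rank is the size of a maximal independent set of columns. With full row rank these
  columns form an invertible square matrix \<open>B\<close>, and a relation among the rows of
  \<open>A\<close> is a vector in the kernel of the transpose of \<open>B\<close>.\<close>

lemma full_row_rank_rows_independent:
  assumes A: "A \<in> carrier_mat n m" and rank: "full_row_rank A"
    and c: "\<And>t. t < m \<Longrightarrow> (\<Sum>i<n. c i * A $$ (i, t)) = 0"
  shows "\<forall>i<n. c i = 0"
proof -
  interpret vec_space "TYPE(real)" n .
  have cs: "set (cols A) \<subseteq> carrier_vec n" using cols_dim A by blast
  obtain S where S: "maximal S (\<lambda>T. T \<subseteq> set (cols A) \<and> lin_indpt T)"
    using maximal_exists_superset[of "set (cols A)" "\<lambda>T. T \<subseteq> set (cols A) \<and> lin_indpt T" "{}"]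
    by (auto simp: finite_lin_indpt2)
  then have S': "S \<subseteq> set (cols A)" "lin_indpt S" by (auto simp: maximal_def)
  have card: "card S = n"
    using rank_card_indpt[OF A S] rank A by (simp add: full_row_rank_def)
  have finS: "finite S" using S'(1) finite_subset by blast
  obtain ss where ss: "set ss = S" "distinct ss" using finite_distinct_list[OF finS] by blast
  have len: "length ss = n" using ss card distinct_card by force
  define B where "B = mat_of_cols n ss"
  have B: "B \<in> carrier_mat n n" using len by (simp add: B_def mat_of_cols_def)
  have colsB: "cols B = ss"
    unfolding B_def using ss S' cs by (intro cols_mat_of_cols) auto
  have "rank B = n"
    using lin_indpt_full_rank[OF B] ss S' colsB by simp
  then have "det B \<noteq> 0" using det_rank_iff[OF B] by simp
  then have det: "det (transpose_mat B) \<noteq> 0" using det_transpose[OF B] by simp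
  define v where "v = vec n c"
  have "transpose_mat B *\<^sub>v v = 0\<^sub>v n"
  proof (rule eq_vecI)
    fix k assume k: "k < dim_vec (0\<^sub>v n :: real vec)"
    then have "col B k \<in> set (cols A)"
      using S'(1) ss len colsB B
          by (metis carrier_matD(2) cols_nth index_zero_vec(2) nth_mem subsetD)
    then obtain t where t: "t < m" "col B k = col A t"
      using A by (auto simp: cols_def)
    have "(transpose_mat B *\<^sub>v v) $ k = col A t \<bullet> v"
      using k B t by simp
    also have "\<dots> = (\<Sum>i<n. c i * A $$ (i, t))"
      using A t by (auto simp: scalar_prod_def v_def atLeast0LessThan intro!: sum.cong)
    finally show "(transpose_mat B *\<^sub>v v) $ k = 0\<^sub>v n $ k" using c t k by simp
  qed (use B in auto)
  then have "v = 0\<^sub>v n"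
    using det det_0_iff_vec_prod_zero_field[of "transpose_mat B" n] B
    by (metis transpose_carrier_mat v_def vec_carrier)
  then show ?thesis by (auto simp: v_def vec_eq_iff)
qed

subsection \<open>The centralizer of the Jordan matrix\<close>

lemma K_mat_carrier: "K_mat r e \<in> carrier_mat (r * e) (r * e)"
  by (rule carrier_matI) (simp_all add: K_mat_def kronecker_def jordan_block_def)

lemma K_mat_index:
  assumes "i < r" "k < r" "a < e" "b < e"
  shows "K_mat r e $$ (i * e + a, k * e + b) = (if Suc i = k \<and> a = b then 1 else 0)"
proof -
  have "i * e + a < r * e" "k * e + b < r * e"
    using assms by (auto intro: mult_add_less)
  then show ?thesis
    using assms by (simp add: K_mat_def kronecker_def jordan_block_def div_mult_self3 mult.commute)
qed

text \<open>Since levels descend, passing from \<open>p\<close> to \<open>Suc p\<close> puts the new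
  Jordan block in the upper left corner; this drives the inductions on \<open>p\<close>.\<close>

lemma F_mat_Suc:
  "F_mat d (Suc p) = four_block_mat (K_mat (Suc p) (d (Suc p)))
     (0\<^sub>m (Suc p * d (Suc p)) (dim_col (F_mat d p))) (0\<^sub>m (dim_row (F_mat d p)) (Suc p * d (Suc p)))
     (F_mat d p)"
  using K_mat_carrier[of "Suc p" "d (Suc p)"]
  by (simp add: F_mat_def Let_def)

lemma F_mat_carrier: "F_mat d p \<in> carrier_mat (n_min d p) (n_min d p)"
proof (induction p)
  case 0
  show ?case by (simp add: F_mat_def n_min_def)
next
  case (Suc p)
  have "n_min d (Suc p) = Suc p * d (Suc p) + n_min d p" by (simp add: n_min_def)
  then show ?case
    unfolding F_mat_Suc using K_mat_carrier[of "Suc p" "d (Suc p)"] Suc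
    by (metis four_block_carrier_mat)
qed

lemma block_pos_Suc:
  "r \<le> p \<Longrightarrow> block_pos d (Suc p) (r, j, a) = Suc p * d (Suc p) + block_pos d p (r, j, a)"
  "block_pos d (Suc p) (Suc p, j, a) = (p - j) * d (Suc p) + a"
  by (simp_all add: block_start_def)

text \<open>Within a level \<open>j\<close> decreases with the position, so the superdiagonal of the
  Jordan block leads from row index \<open>Suc j'\<close> to column index \<open>j'\<close>.\<close>

lemma F_mat_index:
  assumes "(r, j, a) \<in> blocks d p" "(r', j', a') \<in> blocks d p"
  shows "F_mat d p $$ (block_pos d p (r, j, a), block_pos d p (r', j', a'))
    = (if (r, j, a) = (r', Suc j', a') then 1 else 0)"
  using assms
proof (induction p)
  case (Suc p)
  let ?n = "Suc p * d (Suc p)" and ?e = "d (Suc p)"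
  have K: "dim_row (K_mat (Suc p) ?e) = ?n" "dim_col (K_mat (Suc p) ?e) = ?n"
    using K_mat_carrier by blast+
  have F: "dim_row (F_mat d p) = n_min d p" "dim_col (F_mat d p) = n_min d p"
    using F_mat_carrier by blast+
  have n: "n_min d (Suc p) = ?n + n_min d p" by (simp add: n_min_def)
  let ?i = "block_pos d (Suc p) (r, j, a)" and ?k = "block_pos d (Suc p) (r', j', a')"
  have lt: "?i < ?n + n_min d p" "?k < ?n + n_min d p"
    using Suc.prems block_pos_lt_n_min unfolding n[symmetric] by blast+
  have F_index: "F_mat d (Suc p) $$ (?i, ?k) = (if ?i < ?n then
        if ?k < ?n then K_mat (Suc p) ?e $$ (?i, ?k) else 0
      else if ?k < ?n then 0 else F_mat d p $$ (?i - ?n, ?k - ?n))"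
  proof -
    have "?i < dim_row (K_mat (Suc p) ?e) + dim_row (F_mat d p)"
      "?k < dim_col (K_mat (Suc p) ?e) + dim_col (F_mat d p)" using lt K F by simp_all
    note four_block = index_mat_four_block(1)[OF this]
    show ?thesis
      unfolding F_mat_Suc four_block
      using lt by (auto simp: K F simp del: block_pos.simps)
  qed
  have top: "(p - j) * ?e + a < ?n" if "(Suc p, j, a) \<in> blocks d (Suc p)" for j a
    using that by (intro mult_add_less) auto
  show ?case
  \<comment> \<open>The cases are the four corners of \<open>four_block_mat\<close>; in the last one
    both positions are shifted by \<open>?n\<close> and the induction hypothesis applies.\<close>
  proof (cases "r = Suc p"; cases "r' = Suc p")
    assume "r = Suc p" "r' = Suc p"
    then show ?thesis
      using Suc.prems top K_mat_index[of "p - j" "Suc p" "p - j'" a ?e a']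
      unfolding F_index by (auto simp: block_pos_Suc simp del: block_pos.simps mult_Suc)
  next
    assume "r = Suc p" "r' \<noteq> Suc p"
    then show ?thesis
      using Suc.prems top unfolding F_index by (auto simp: block_pos_Suc simp
          del: block_pos.simps mult_Suc)
  next
    assume "r \<noteq> Suc p" "r' = Suc p"
    then show ?thesis
      using Suc.prems top unfolding F_index by (auto simp: block_pos_Suc simp
          del: block_pos.simps mult_Suc)
  next
    assume "r \<noteq> Suc p" "r' \<noteq> Suc p"
    then show ?thesis
      using Suc unfolding F_index by (simp add: block_pos_Suc del: block_pos.simps mult_Suc)
  qed
qed simp

text \<open>The general matrix commuting with \<open>F\<close>: \<open>t l\<close> is the matrix of the blocks \<open>S\<^bsub>\<rho>,l;\<rho>',0\<^esub>\<close>, and its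
  entries with \<open>\<rho> > l + \<rho>'\<close> are ignored.\<close>

fun toeplitz :: "(nat \<Rightarrow> nat \<times> nat \<Rightarrow> nat \<times> nat \<Rightarrow> real) \<Rightarrow> nat \<times> nat \<times> nat \<Rightarrow> nat \<times> nat \<times> nat \<Rightarrow> real" where
  "toeplitz t (r, j, a) (r', j', a') =
    (if j' \<le> j \<and> r + j' \<le> j + r' then t (j - j') (r, a) (r', a') else 0)"

text \<open>Column \<open>(r, j, a)\<close> of \<open>F\<close> has its only entry in row
  \<open>(r, Suc j, a)\<close>, and none if \<open>j = r - 1\<close>: right multiplication shifts
  columns.\<close>

lemma mult_F_mat_index:
  assumes S: "S \<in> carrier_mat (n_min d p) (n_min d p)"
    and x: "x \<in> blocks d p" and y: "(r, j, a) \<in> blocks d p"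
  shows "(S * F_mat d p) $$ (block_pos d p x, block_pos d p (r, j, a))
    = (if Suc j < r then S $$ (block_pos d p x, block_pos d p (r, Suc j, a)) else 0)"
proof -
  have "(S * F_mat d p) $$ (block_pos d p x, block_pos d p (r, j, a))
      = (\<Sum>z\<in>blocks d p. S $$ (block_pos d p x, block_pos d p z)
          * F_mat d p $$ (block_pos d p z, block_pos d p (r, j, a)))"
    using mult_mat_eq_sum[OF S F_mat_carrier] block_pos_lt_n_min[OF x] block_pos_lt_n_min[OF y]
    by (simp only: sum_block_pos)
  also have "\<dots> = (\<Sum>z\<in>blocks d p.
        if z = (r, Suc j, a) then S $$ (block_pos d p x, block_pos d p z) else 0)"
  proof (intro sum.cong refl)
    fix z assume "z \<in> blocks d p"
    then show "S $$ (block_pos d p x, block_pos d p z)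
        * F_mat d p $$ (block_pos d p z, block_pos d p (r, j, a))
        = (if z = (r, Suc j, a) then S $$ (block_pos d p x, block_pos d p z) else 0)"
      using F_mat_index[of _ _ _ d p r j a] y by (cases z)
          (simp del: block_pos.simps blocks_iff prod.inject)
  qed
  also have "\<dots> = (if Suc j < r then S $$ (block_pos d p x, block_pos d p (r, Suc j, a)) else 0)"
    using y by (simp add: sum.delta del: block_pos.simps)
  finally show ?thesis .
qed

lemma F_mat_mult_index:
  assumes S: "S \<in> carrier_mat (n_min d p) (n_min d p)"
    and x: "(r, j, a) \<in> blocks d p" and y: "y \<in> blocks d p"
  shows "(F_mat d p * S) $$ (block_pos d p (r, j, a), block_pos d p y)
    = (if 0 < j then S $$ (block_pos d p (r, j - 1, a), block_pos d p y) else 0)"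
proof -
  have "(F_mat d p * S) $$ (block_pos d p (r, j, a), block_pos d p y)
      = (\<Sum>z\<in>blocks d p. F_mat d p $$ (block_pos d p (r, j, a), block_pos d p z)
          * S $$ (block_pos d p z, block_pos d p y))"
    using mult_mat_eq_sum[OF F_mat_carrier S] block_pos_lt_n_min[OF x] block_pos_lt_n_min[OF y]
    by (simp only: sum_block_pos)
  also have "\<dots> = (\<Sum>z\<in>blocks d p.
        if z = (r, j - 1, a) then if 0 < j then S $$ (block_pos d p z, block_pos d p y) else 0 else 0)"
  proof (intro sum.cong refl)
    fix z assume z: "z \<in> blocks d p"
    \<comment> \<open>Left multiplication shifts rows. The guard \<open>0 < j\<close> is essential,
      since \<open>j - 1\<close> equals \<open>j\<close> for \<open>j = 0\<close>.\<close>
    have "F_mat d p $$ (block_pos d p (r, j, a), block_pos d p z) =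
          (if 0 < j \<and> z = (r, j - 1, a) then 1 else 0)"
      using F_mat_index[of r j a d p] x z by (cases z; cases j)
          (auto simp del: block_pos.simps blocks_iff)
    then show "F_mat d p $$ (block_pos d p (r, j, a), block_pos d p z)
        * S $$ (block_pos d p z, block_pos d p y)
        = (if z = (r, j - 1, a) then if 0 < j then S $$ (block_pos d p z, block_pos d p y) else 0
            else 0)"
      by simp
  qed
  also have "\<dots> = (if 0 < j then S $$ (block_pos d p (r, j - 1, a), block_pos d p y) else 0)"
    using x by (auto simp: sum.delta simp del: block_pos.simps)
  finally show ?thesis .
qed

text \<open>The shift identity makes \<open>s\<close> constant along the diagonals of fixed
  \<open>j - j'\<close>. At the borders \<open>j = 0\<close> and \<open>j' = r' - 1\<close> one side
  of it is 0, which kills the diagonals outside the support of \<open>toeplitz\<close>.\<close>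

lemma toeplitz_iff_shift_invariant:
  fixes s :: "nat \<times> nat \<times> nat \<Rightarrow> nat \<times> nat \<times> nat \<Rightarrow> real"
  shows "(\<forall>r j a r' j' a'. (r, j, a) \<in> blocks d p \<longrightarrow> (r', j', a') \<in> blocks d p \<longrightarrow>
      (if Suc j' < r' then s (r, j, a) (r', Suc j', a') else 0)
        = (if 0 < j then s (r, j - 1, a) (r', j', a') else 0))
    \<longleftrightarrow> (\<exists>t. \<forall>x\<in>blocks d p. \<forall>y\<in>blocks d p. s x y = toeplitz t x y)"
    (is "?shift \<longleftrightarrow> (\<exists>t. ?toeplitz t)")
proof
  assume shift: ?shift
  define t where "t l x y = s (fst x, l, snd x) (at_zero y)" for l x y
  have diag: "s (r, j, a) (r', 0, a') = s (r, j + i, a) (r', i, a')"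
    if "r' \<le> p" "a' < d r'" "r \<le> p" "a < d r" "i < r'" "j + i < r" for r j a r' a' i
    using that
  proof (induction i)
    case (Suc i)
    then show ?case
      using shift[rule_format, of r "Suc (j + i)" a r' i a'] by simp
  qed simp
  \<comment> \<open>Follow the diagonal down to the last column \<open>r' - 1\<close>. As
    \<open>j + r' < r\<close>, the next row still exists but the next column does not, so the
    identity gives 0.\<close>
  have zero: "s (r, j, a) (r', 0, a') = 0"
    if "(r, j, a) \<in> blocks d p" "(r', 0, a') \<in> blocks d p" "j + r' < r" for r j a r' a'
    using diag[of r' a' r a "r' - 1" j] shift[rule_format, of r "j + r'" a r' "r' - 1" a'] that
    by auto
  have "s (r, j, a) (r', j', a') = toeplitz t (r, j, a) (r', j', a')"
    if "(r, j, a) \<in> blocks d p" "(r', j', a') \<in> blocks d p" for r j a r' j' a'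
    using that
  proof (induction j' arbitrary: j)
    case 0
    then show ?case using zero[of r j a r' a'] by (auto simp: t_def)
  next
    case (Suc j')
    have "s (r, j, a) (r', Suc j', a') = (if 0 < j then s (r, j - 1, a) (r', j', a') else 0)"
      using shift[rule_format, of r j a r' j' a'] Suc.prems by simp
    also have "\<dots> = toeplitz t (r, j, a) (r', Suc j', a')"
      using Suc by (cases j) auto
    finally show ?case .
  qed
  then have "?toeplitz t" by (simp only: Ball_def split_paired_All) blast
  then show "\<exists>t. ?toeplitz t" by (intro exI[of _ t])
next
  assume "\<exists>t. ?toeplitz t"
  then obtain t where s: "?toeplitz t" by (rule exE)
  show ?shift
  proof (intro allI impI)
    fix r j a r' j' a' assume xy: "(r, j, a) \<in> blocks d p" "(r', j', a') \<in> blocks d p"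
    have "s (r, j, a) (r', Suc j', a') = toeplitz t (r, j, a) (r', Suc j', a')" if "Suc j' < r'"
      using s xy that by (simp del: toeplitz.simps)
    moreover have "(r, j - 1, a) \<in> blocks d p" using xy by auto
    then have "s (r, j - 1, a) (r', j', a') = toeplitz t (r, j - 1, a) (r', j', a')"
      using s xy by blast
    ultimately show "(if Suc j' < r' then s (r, j, a) (r', Suc j', a') else 0)
        = (if 0 < j then s (r, j - 1, a) (r', j', a') else 0)"
      using xy by (cases j) auto
  qed
qed

lemma mat_eq_block_pos_iff:
  assumes "A \<in> carrier_mat (n_min d p) (n_min d p)" "B \<in> carrier_mat (n_min d p) (n_min d p)"
  shows "A = B \<longleftrightarrow> (\<forall>x\<in>blocks d p. \<forall>y\<in>blocks d p. A $$ (block_pos d p x, block_pos d p y)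
      = B $$ (block_pos d p x, block_pos d p y))"
proof
  assume eq: "\<forall>x\<in>blocks d p. \<forall>y\<in>blocks d p. A $$ (block_pos d p x, block_pos d p y)
      = B $$ (block_pos d p x, block_pos d p y)"
  show "A = B"
  proof (rule eq_matI)
    fix i k assume "i < dim_row B" "k < dim_col B"
    then have "i < n_min d p" "k < n_min d p" using assms by auto
    then show "A $$ (i, k) = B $$ (i, k)" using eq by (elim block_pos_cases) blast
  qed (use assms in auto)
qed simp

text \<open>Compared entrywise, the column shift \<open>S F\<close> and the row shift
  \<open>F S\<close> agree exactly when the entries of \<open>S\<close> are shift invariant.\<close>

lemma commutes_F_mat_iff:
  assumes S: "S \<in> carrier_mat (n_min d p) (n_min d p)"
  shows "S * F_mat d p = F_mat d p * S
    \<longleftrightarrow> (\<exists>t. \<forall>x\<in>blocks d p. \<forall>y\<in>blocks d p. S $$ (block_pos d p x, block_pos d p y) = toeplitz t x y)"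
proof -
  have "S * F_mat d p = F_mat d p * S \<longleftrightarrow>
    (\<forall>x\<in>blocks d p. \<forall>y\<in>blocks d p. (S * F_mat d p) $$ (block_pos d p x, block_pos d p y)
        = (F_mat d p * S) $$ (block_pos d p x, block_pos d p y))"
    by (rule mat_eq_block_pos_iff) (use S F_mat_carrier in \<open>auto intro: mult_carrier_mat\<close>)
  also have "\<dots> \<longleftrightarrow> (\<forall>r j a r' j' a'. (r, j, a) \<in> blocks d p \<longrightarrow> (r', j', a') \<in> blocks d p \<longrightarrow>
      (S * F_mat d p) $$ (block_pos d p (r, j, a), block_pos d p (r', j', a'))
        = (F_mat d p * S) $$ (block_pos d p (r, j, a), block_pos d p (r', j', a')))"
    by (simp only: Ball_def split_paired_All) blast
  also have "\<dots> \<longleftrightarrow> (\<forall>r j a r' j' a'. (r, j, a) \<in> blocks d p \<longrightarrow> (r', j', a') \<in> blocks d p \<longrightarrow>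
      (if Suc j' < r' then S $$ (block_pos d p (r, j, a), block_pos d p (r', Suc j', a')) else 0)
        = (if 0 < j then S $$ (block_pos d p (r, j - 1, a), block_pos d p (r', j', a')) else 0))"
    by (simp only: mult_F_mat_index[OF S] F_mat_mult_index[OF S] cong: imp_cong)
  also have "\<dots> \<longleftrightarrow> (\<exists>t. \<forall>x\<in>blocks d p. \<forall>y\<in>blocks d p. S $$ (block_pos d p x, block_pos d p y)
      = toeplitz t x y)"
    by (rule toeplitz_iff_shift_invariant[of d p "\<lambda>x y. S $$ (block_pos d p x, block_pos d p y)"])
  finally show ?thesis .
qed

lemma Centr_F_mat_iff:
  "S \<in> Centr (F_mat d p) \<longleftrightarrow> S \<in> carrier_mat (n_min d p) (n_min d p) \<and> invertible_mat S
    \<and> (\<exists>t. \<forall>x\<in>blocks d p. \<forall>y\<in>blocks d p. S $$ (block_pos d p x, block_pos d p y) = toeplitz t x y)"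
  using commutes_F_mat_iff[of S d p] carrier_matD(1)[OF F_mat_carrier[of d p]]
  by (auto simp: Centr_def)

subsection \<open>Solving the orthogonality conditions\<close>

text \<open>The contribution of the blocks \<open>G\<^bsub>\<rho>,j\<^esub>\<close> with \<open>j > 0\<close> to \<open>S G\<close>. On the level \<open>l\<close> it involves only
  the \<open>t k\<close> with \<open>k < l\<close>, which makes the conditions solvable by recursion on the level.\<close>

definition higher_part :: "(nat \<Rightarrow> nat) \<Rightarrow> nat \<Rightarrow> (nat \<times> nat \<times> nat \<Rightarrow> nat \<Rightarrow> real) \<Rightarrow>
    (nat \<Rightarrow> nat \<times> nat \<Rightarrow> nat \<times> nat \<Rightarrow> real) \<Rightarrow> nat \<times> nat \<times> nat \<Rightarrow> nat \<Rightarrow> real" where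
  "higher_part d p g t x c = (\<Sum>y\<in>{y\<in>blocks d p. 0 < fst (snd y)}. toeplitz t x y * g y c)"

lemma sum_blocks_split:
  "(\<Sum>y\<in>blocks d p. f y)
      = (\<Sum>y\<in>levels d p. f (at_zero y)) + (\<Sum>y\<in>{y\<in>blocks d p. 0 < fst (snd y)}. f y)"
proof -
  have "at_zero ` levels d p = {y\<in>blocks d p. \<not> 0 < fst (snd y)}"
  proof (intro equalityI subsetI)
    fix y assume "y \<in> {y\<in>blocks d p. \<not> 0 < fst (snd y)}"
    then have "y = at_zero (fst y, snd (snd y))" "(fst y, snd (snd y)) \<in> levels d p"
      by (cases y; simp)+
    then show "y \<in> at_zero ` levels d p" by blast
  qed auto
  then have "(\<Sum>y\<in>levels d p. f (at_zero y)) = (\<Sum>y\<in>{y\<in>blocks d p. \<not> 0 < fst (snd y)}. f y)"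
    using sum.reindex[OF inj_at_zero, of f "levels d p"] by simp
  moreover have "(\<Sum>y\<in>blocks d p. f y) = (\<Sum>y\<in>{y\<in>blocks d p. \<not> 0 < fst (snd y)}. f y)
      + (\<Sum>y\<in>{y\<in>blocks d p. 0 < fst (snd y)}. f y)"
    by (subst sum.union_disjoint[symmetric]) (auto intro: sum.cong)
  ultimately show ?thesis by simp
qed

text \<open>With truncated subtraction \<open>r - l \<le> fst y\<close> means
  \<open>r \<le> l + fst y\<close>, the support of \<open>toeplitz\<close> for
  \<open>j' = 0\<close>. This separates the unknown \<open>t l\<close> from the contribution of
  smaller levels.\<close>

lemma sum_toeplitz:
  "(\<Sum>y\<in>blocks d p. toeplitz t (r, l, a) y * g y c)
    = (\<Sum>y\<in>{y\<in>levels d p. r - l \<le> fst y}. t l (r, a) y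
        * g (at_zero y) c) + higher_part d p g t (r, l, a) c"
proof -
  have "(\<Sum>y\<in>levels d p. toeplitz t (r, l, a) (at_zero y) * g (at_zero y) c)
      = (\<Sum>y\<in>{y\<in>levels d p. r - l \<le> fst y}. t l (r, a) y * g (at_zero y) c)"
    by (rule sum.mono_neutral_cong_right) (auto split: if_splits)
  then show ?thesis by (simp add: sum_blocks_split[where f
      = "\<lambda>y. toeplitz t (r, l, a) y * g y c"] higher_part_def)
qed

text \<open>The families are compared only on the entries that \<open>toeplitz\<close> reads;
  elsewhere two representations of the same matrix may differ.\<close>

lemma higher_part_cong:
  assumes "(r, l, a) \<in> blocks d p"
    and "\<And>k y. k < l \<Longrightarrow> y \<in> levels d p \<Longrightarrow> r \<le> k + fst y \<Longrightarrow> t k (r, a) y = t' k (r, a) y"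
  shows "higher_part d p g t (r, l, a) c = higher_part d p g t' (r, l, a) c"
  unfolding higher_part_def
proof (intro sum.cong refl)
  fix y assume "y \<in> {y\<in>blocks d p. 0 < fst (snd y)}"
  moreover obtain r' j' a' where y: "y = (r', j', a')" by (cases y)
  moreover have "r \<le> (l - j') + r'" if "j' \<le> l" "r + j' \<le> l + r'" using that by linarith
  ultimately show "toeplitz t (r, l, a) y * g y c = toeplitz t' (r, l, a) y * g y c"
    using assms(2)[of "l - j'" "(r', a')"] by auto
qed

lemma higher_part_0: "higher_part d p g t (r, 0, a) c = 0"
  unfolding higher_part_def by (rule sum.neutral) auto

text \<open>The data of the problem freed from matrix positions: \<open>g\<close> are the rows of
  \<open>G\<close>, \<open>L\<close> is the prescribed zero part, and \<open>q\<close> are the rows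
  of the normalized stack, orthonormal by (i).\<close>

locale orthonormal_zero_rows =
  fixes d :: "nat \<Rightarrow> nat" and p m :: nat and g :: "nat \<times> nat \<times> nat \<Rightarrow> nat \<Rightarrow> real"
    and L :: "nat \<times> nat \<Rightarrow> nat \<times> nat \<Rightarrow> real" and q :: "nat \<times> nat \<Rightarrow> nat \<Rightarrow> real"
  assumes tri: "\<And>x y. x \<in> levels d p \<Longrightarrow> y \<in> levels d p \<Longrightarrow> fst y < fst x \<Longrightarrow> L x y = 0"
    and q: "\<And>x c. x \<in> levels d p \<Longrightarrow> c < m \<Longrightarrow> q x c = (\<Sum>y\<in>levels d p. L x y * g (at_zero y) c)"
    and on: "\<And>x y. x \<in> levels d p \<Longrightarrow> y \<in> levels d p \<Longrightarrow>
      (\<Sum>c<m. q x c * q y c) = (if x = y then 1 else 0)"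
begin

definition M :: "nat \<times> nat \<Rightarrow> nat \<times> nat \<Rightarrow> real" where
  "M y z = (\<Sum>c<m. g (at_zero y) c * q z c)"

text \<open>The solution \<open>e L\<close> of \<open>u M = e\<close> on the levels from
  \<open>fst x - l\<close> on, where \<open>e\<close> is minus the product of the higher part with
  \<open>q\<close>. It depends on \<open>t\<close> only through the \<open>t k\<close> with
  \<open>k < l\<close>.\<close>

definition level_rhs :: "(nat \<Rightarrow> nat \<times> nat \<Rightarrow> nat \<times> nat \<Rightarrow> real) \<Rightarrow> nat \<Rightarrow> nat \<times> nat \<Rightarrow> nat \<times> nat \<Rightarrow> real" where
  "level_rhs t l x y = (\<Sum>z\<in>{z\<in>levels d p. fst x - l \<le> fst z}.
     - (\<Sum>c<m. higher_part d p g t (fst x, l, snd x) c * q z c) * L z y)"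

text \<open>With Q the matrix of the \<open>q x\<close>, the product \<open>L M\<close> is Q Q', the
  identity by orthonormality.\<close>

lemma L_M:
  assumes "x \<in> levels d p" "z \<in> levels d p"
  shows "(\<Sum>y\<in>levels d p. L x y * M y z) = (if x = z then 1 else 0)"
proof -
  have "(\<Sum>y\<in>levels d p. L x y * M y z) = (\<Sum>c<m. (\<Sum>y\<in>levels d p. L x y * g (at_zero y) c) * q z c)"
    unfolding M_def sum_distrib_left sum_distrib_right
    by (subst sum.swap) (simp add: mult.assoc)
  also have "\<dots> = (\<Sum>c<m. q x c * q z c)"
    using assms by (intro sum.cong) (auto simp: q)
  finally show ?thesis using on assms by simp
qed

text \<open>Splitting off the higher part turns orthogonality to the \<open>q z\<close> into a row
  system for \<open>t l\<close> whose matrix is the minor of \<open>M\<close> on the levels from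
  \<open>r - l\<close> on.\<close>

lemma orthogonality_iff:
  "(\<forall>z\<in>{z\<in>levels d p. r - l \<le> fst z}.
      (\<Sum>c<m. (\<Sum>y\<in>blocks d p. toeplitz t (r, l, a) y * g y c) * q z c) = 0)
    \<longleftrightarrow> (\<forall>y\<in>{y\<in>levels d p. r - l \<le> fst y}. t l (r, a) y = level_rhs t l (r, a) y)"
proof -
  let ?X = "{y\<in>levels d p. r - l \<le> fst y}"
  have "(\<Sum>c<m. (\<Sum>y\<in>blocks d p. toeplitz t (r, l, a) y * g y c) * q z c)
      = (\<Sum>y\<in>?X. t l (r, a) y * M y z) + (\<Sum>c<m. higher_part d p g t (r, l, a) c * q z c)" for z
  proof -
    have "(\<Sum>c<m. (\<Sum>y\<in>?X. t l (r, a) y * g (at_zero y) c) * q z c) = (\<Sum>y\<in>?X. t l (r, a) y * M y z)"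
      unfolding M_def sum_distrib_left sum_distrib_right
      by (subst sum.swap) (simp add: mult.assoc)
    then show ?thesis by (simp only: sum_toeplitz distrib_right sum.distrib)
  qed
  then have "(\<forall>z\<in>?X. (\<Sum>c<m. (\<Sum>y\<in>blocks d p. toeplitz t (r, l, a) y * g y c) * q z c) = 0)
     \<longleftrightarrow> (\<forall>z\<in>?X. (\<Sum>y\<in>?X. t l (r, a) y * M y z) = - (\<Sum>c<m. higher_part d p g t (r, l, a) c * q z c))"
    by (simp add: eq_neg_iff_add_eq_0)
  also have "\<dots> \<longleftrightarrow> (\<forall>y\<in>?X. t l (r, a) y = level_rhs t l (r, a) y)"
    unfolding level_rhs_def fst_conv snd_conv
    by (rule triangular_minor_solve[where h = fst]) (auto simp: tri L_M)
  finally show ?thesis .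
qed

lemma solution_exists:
  "\<exists>t. t 0 = L \<and> (\<forall>r l a. (r, l, a) \<in> blocks d p \<longrightarrow> 0 < l \<longrightarrow> t l (r, a) = level_rhs t l (r, a))"
proof -
  have "\<exists>t. \<forall>l. (l = 0 \<longrightarrow> t l = L) \<and>
      (\<forall>r a. (r, l, a) \<in> blocks d p \<longrightarrow> 0 < l \<longrightarrow> t l (r, a) = level_rhs t l (r, a))"
  \<comment> \<open>Course-of-values recursion on \<open>l\<close>, started at \<open>L\<close>; it
    is legitimate because \<open>level_rhs\<close> reads only smaller levels.\<close>
  proof (rule dependent_wellorder_choice)
    fix f f' :: "nat \<Rightarrow> nat \<times> nat \<Rightarrow> nat \<times> nat \<Rightarrow> real" and u l
    assume "\<And>k. k < l \<Longrightarrow> f k = f' k"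
    then have "higher_part d p g f (r, l, a) = higher_part d p g f' (r, l, a)"
        if "(r, l, a) \<in> blocks d p" for r a
      using that by (intro ext higher_part_cong) auto
    then have "level_rhs f l (r, a) = level_rhs f' l (r, a)" if "(r, l, a) \<in> blocks d p" for r a
      unfolding level_rhs_def fst_conv snd_conv using that by presburger
    then show "((l = 0 \<longrightarrow> u = L) \<and> (\<forall>r a. (r, l, a) \<in> blocks d p \<longrightarrow> 0 < l \<longrightarrow> u (r, a)
        = level_rhs f l (r, a)))
      = ((l = 0 \<longrightarrow> u = L) \<and> (\<forall>r a. (r, l, a) \<in> blocks d p \<longrightarrow> 0 < l \<longrightarrow> u (r, a)
          = level_rhs f' l (r, a)))"
      by auto
  next
    fix l f
    show "\<exists>u. (l = 0 \<longrightarrow> u = L) \<and> (\<forall>r a. (r, l, a) \<in> blocks d p \<longrightarrow> 0 < l \<longrightarrow> u (r, a)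
        = level_rhs f l (r, a))"
      by (rule exI[of _ "if l = 0 then L else level_rhs f l"]) simp
  qed
  then show ?thesis by blast
qed

text \<open>Strong induction on \<open>l\<close>: agreement on smaller levels equates the higher
  parts, hence the right-hand sides. Only entries inside the support of \<open>toeplitz\<close> can
  be compared.\<close>

lemma solution_unique:
  assumes t0: "\<And>x y. x \<in> levels d p \<Longrightarrow> y \<in> levels d p \<Longrightarrow> fst x \<le> fst y \<Longrightarrow> t 0 x y = t' 0 x y"
    and t: "\<And>r l a y. (r, l, a) \<in> blocks d p \<Longrightarrow> 0 < l \<Longrightarrow> y \<in> levels d p \<Longrightarrow> r - l \<le> fst y
      \<Longrightarrow> t l (r, a) y = level_rhs t l (r, a) y"
    and t': "\<And>r l a y. (r, l, a) \<in> blocks d p \<Longrightarrow> 0 < l \<Longrightarrow> y \<in> levels d p \<Longrightarrow> r - l \<le> fst y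
      \<Longrightarrow> t' l (r, a) y = level_rhs t' l (r, a) y"
    and "(r, l, a) \<in> blocks d p" "y \<in> levels d p" "r - l \<le> fst y"
  shows "t l (r, a) y = t' l (r, a) y"
  using assms(4-)
proof (induction l arbitrary: y rule: less_induct)
  case (less l)
  show ?case
  proof (cases "l = 0")
    case True
    then show ?thesis using t0 less.prems by simp
  next
    case False
    have "higher_part d p g t (r, l, a) = higher_part d p g t' (r, l, a)"
    proof (intro ext higher_part_cong less.prems)
      fix k y assume "k < l" "y \<in> levels d p" "r \<le> k + fst y"
      then show "t k (r, a) y = t' k (r, a) y"
        using less.prems by (intro less.IH) auto
    qed
    then have "level_rhs t l (r, a) y = level_rhs t' l (r, a) y" by (simp add: level_rhs_def)
    then show ?thesis using t[OF less.prems(1)] t'[OF less.prems(1)] less.prems False by simp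
  qed
qed

text \<open>For fixed \<open>j\<close>, the diagonal part of \<open>S\<close> acting on the blocks \<open>(\<rho>, j)\<close> is the minor of \<open>L\<close> on the
  levels \<open>\<rho> > j\<close>, which is invertible by triangularity.\<close>

lemma toeplitz_kernel_trivial:
  assumes t0: "\<And>x y. x \<in> levels d p \<Longrightarrow> y \<in> levels d p \<Longrightarrow> fst x \<le> fst y \<Longrightarrow> t 0 x y = L x y"
    and v: "\<And>x. x \<in> blocks d p \<Longrightarrow> (\<Sum>y\<in>blocks d p. toeplitz t x y * v y) = 0"
    and "(r, j, a) \<in> blocks d p"
  shows "v (r, j, a) = 0"
  using assms(3)
proof (induction j arbitrary: r a rule: less_induct)
  case (less j)
  let ?X = "{x\<in>levels d p. Suc j \<le> fst x}"
  let ?e = "\<lambda>(r, a). (r, j, a)"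
  let ?v = "\<lambda>x. v (?e x)"
  have eX: "?e ` ?X = {y\<in>blocks d p. fst (snd y) = j}"
  proof (intro equalityI subsetI)
    fix y assume "y \<in> {y\<in>blocks d p. fst (snd y) = j}"
    then have "y = ?e (fst y, snd (snd y))" "(fst y, snd (snd y)) \<in> ?X"
      by (cases y; simp)+
    then show "y \<in> ?e ` ?X" by blast
  qed auto
  have Lv: "(\<Sum>y\<in>?X. L x y * ?v y) = 0" if x: "x \<in> ?X" for x
  proof -
    have xb: "?e x \<in> blocks d p" using x by (cases x) auto
    have "0 = (\<Sum>y\<in>blocks d p. toeplitz t (?e x) y * v y)" using v[OF xb] by simp
    also have "\<dots> = (\<Sum>y\<in>{y\<in>blocks d p. fst (snd y) = j}. toeplitz t (?e x) y * v y)"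
    proof (intro sum.mono_neutral_right ballI)
      fix y assume y: "y \<in> blocks d p - {y\<in>blocks d p. fst (snd y) = j}"
      obtain r' j' a' where y': "y = (r', j', a')" by (cases y)
      \<comment> \<open>Terms with \<open>j' < j\<close> vanish by the induction hypothesis on
        \<open>v\<close>, those with \<open>j' > j\<close> by the shape of
        \<open>toeplitz\<close>.\<close>
      show "toeplitz t (?e x) y * v y = 0"
      proof (cases "j' < j")
        case True
        then show ?thesis using less.IH[of j' r' a'] y y' by simp
      next
        case False
        then show ?thesis using y y' by (cases x) auto
      qed
    qed auto
    also have "\<dots> = (\<Sum>y\<in>?X. toeplitz t (?e x) (?e y) * ?v y)"
      unfolding eX[symmetric] by (subst sum.reindex) (auto simp: inj_on_def)
    also have "\<dots> = (\<Sum>y\<in>?X. L x y * ?v y)"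
    proof (intro sum.cong refl)
      fix y assume y: "y \<in> ?X"
      show "toeplitz t (?e x) (?e y) * ?v y = L x y * ?v y"
        using x y t0[of x y] tri[of x y] by (cases x; cases y) auto
    qed
    finally show ?thesis by simp
  qed
  have ml: "(\<Sum>y\<in>?X. M x y * L y z) = (if x = z then 1 else 0)" if "x \<in> ?X" "z \<in> ?X" for x z
  proof (rule finite_left_right_inverse[OF _ _ that])
    show "(\<Sum>y\<in>?X. L x y * M y z) = (if x = z then 1 else 0)" if "x \<in> ?X" "z \<in> ?X" for x z
      using triangular_minor_inverse[OF finite_levels tri L_M that] by simp
  qed simp
  have ra: "(r, a) \<in> ?X" using less.prems by auto
  \<comment> \<open>The minor of \<open>M\<close> is also a left inverse, so it recovers
    \<open>?v\<close> from the vanishing product of \<open>L\<close> with \<open>?v\<close>.\<close>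
  have "?v (r, a) = (\<Sum>z\<in>?X. if (r, a) = z then ?v z else 0)" using ra by simp
  also have "\<dots> = (\<Sum>z\<in>?X. (\<Sum>y\<in>?X. M (r, a) y * L y z) * ?v z)"
    using ml[OF ra] by (intro sum.cong) auto
  also have "\<dots> = (\<Sum>y\<in>?X. M (r, a) y * (\<Sum>z\<in>?X. L y z * ?v z))"
    unfolding sum_distrib_left sum_distrib_right
    by (subst sum.swap) (simp add: mult.assoc)
  also have "\<dots> = 0" using Lv by simp
  finally show ?case by simp
qed

end

section \<open>Back to matrices: existence and uniqueness of \<open>S\<close>\<close>

lemma invertible_mat_if_det_nonzero:
  fixes A :: "'a :: field mat"
  assumes A: "A \<in> carrier_mat n n" and det: "det A \<noteq> 0"
  shows "invertible_mat A"
proof -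
  have "A \<in> Units (ring_mat TYPE('a) n ())" by (rule det_non_zero_imp_unit[OF A det])
  then obtain B where "B \<in> carrier_mat n n" "A * B = 1\<^sub>m n" "B * A = 1\<^sub>m n"
    by (auto simp: Units_def ring_mat_simps)
  then show ?thesis
    using A by (auto simp: invertible_mat_def inverts_mat_def)
qed

lemma mult_mat_block_pos:
  assumes "S \<in> carrier_mat (n_min d p) (n_min d p)" "G \<in> carrier_mat (n_min d p) m"
    and "x \<in> blocks d p" "c < m"
  shows "(S * G) $$ (block_pos d p x, c)
      = (\<Sum>y\<in>blocks d p. S $$ (block_pos d p x, block_pos d p y) * G $$ (block_pos d p y, c))"
  using mult_mat_eq_sum[OF assms(1,2) block_pos_lt_n_min[OF assms(3)] assms(4)]
      by (simp only: sum_block_pos)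

lemma mult_mat_level_pos:
  assumes "L \<in> carrier_mat (\<Sum>i = 1..p. d i) (\<Sum>i = 1..p. d i)" "R \<in> carrier_mat (\<Sum>i = 1..p. d i) m"
    and "x \<in> levels d p" "c < m"
  shows "(L * R) $$ (level_pos d p x, c)
      = (\<Sum>y\<in>levels d p. L $$ (level_pos d p x, level_pos d p y) * R $$ (level_pos d p y, c))"
  using mult_mat_eq_sum[OF assms(1,2) level_pos_lt_sum[OF assms(3)] assms(4)]
      by (simp only: sum_level_pos)

lemma sum_toeplitz_at_zero:
  fixes g :: "nat \<times> nat \<times> nat \<Rightarrow> nat \<Rightarrow> real"
  assumes "x \<in> levels d p"
  shows "(\<Sum>y\<in>blocks d p. toeplitz t (at_zero x) y * g y c)
      = (\<Sum>y\<in>levels d p. toeplitz t (at_zero x) (at_zero y) * g (at_zero y) c)"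
  using higher_part_0[of d p g t "fst x" "snd x" c] sum_blocks_split[of "\<lambda>y. toeplitz t (at_zero x) y * g y c" d p]
  by (cases x) (simp add: higher_part_def)

text \<open>A row of \<open>S\<close> with \<open>j = 0\<close> has nonzero entries only in columns
  with \<open>j' = 0\<close>. So (i) constrains \<open>S\<close> only through its zero part.\<close>

lemma rows_zero_mult:
  assumes S: "S \<in> Centr (F_mat d p)" and G: "G \<in> carrier_mat (n_min d p) m"
  shows "rows_zero d p (S * G) = zero_part d p S * rows_zero d p G"
proof -
  obtain t where Sc: "S \<in> carrier_mat (n_min d p) (n_min d p)"
    and t: "\<And>x y. x \<in> blocks d p \<Longrightarrow> y \<in> blocks d p \<Longrightarrow> S $$ (block_pos d p x, block_pos d p y)
        = toeplitz t x y"
    using S unfolding Centr_F_mat_iff by blast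
  have SG: "S * G \<in> carrier_mat (n_min d p) m" using Sc G by simp
  note R = rows_zero_carrier[OF G] and Z = zero_part_carrier[OF Sc]
  show ?thesis
  proof (rule eq_matI)
    fix i c assume "i < dim_row (zero_part d p S * rows_zero d p G)"
      "c < dim_col (zero_part d p S * rows_zero d p G)"
    then have "i < (\<Sum>i = 1..p. d i)" and c: "c < m"
      using carrier_matD[OF R] carrier_matD[OF Z] by simp_all
    then obtain x where x: "x \<in> levels d p" and i: "i = level_pos d p x" by (elim level_pos_cases)
    have "rows_zero d p (S * G) $$ (i, c)
        = (\<Sum>y\<in>blocks d p. toeplitz t (at_zero x) y * G $$ (block_pos d p y, c))"
      unfolding i rows_zero_index[OF SG x c] mult_mat_block_pos[OF Sc G at_zero_blocks[OF x] c]
      by (intro sum.cong refl) (simp only: t at_zero_blocks[OF x])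
    also have "\<dots> = (\<Sum>y\<in>levels d p. toeplitz t (at_zero x) (at_zero y)
        * G $$ (block_pos d p (at_zero y), c))"
      by (rule sum_toeplitz_at_zero[OF x, where g = "\<lambda>y c. G $$ (block_pos d p y, c)"])
    also have "\<dots> = (\<Sum>y\<in>levels d p. zero_part d p S $$ (level_pos d p x, level_pos d p y)
        * rows_zero d p G $$ (level_pos d p y, c))"
      by (intro sum.cong refl)
        (simp only: zero_part_index[OF Sc x] rows_zero_index[OF G _ c] t at_zero_blocks[OF x] at_zero_blocks)
    also have "\<dots> = (zero_part d p S * rows_zero d p G) $$ (i, c)"
      unfolding i by (rule mult_mat_level_pos[OF Z R x c, symmetric])
    finally show "rows_zero d p (S * G) $$ (i, c) = (zero_part d p S * rows_zero d p G) $$ (i, c)" .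
  qed (use carrier_matD[OF R] carrier_matD[OF Z] carrier_matD[OF rows_zero_carrier[OF SG]] in simp_all)
qed

lemma mult_mult_transpose:
  fixes L R :: "'a :: comm_semiring_0 mat"
  assumes "L \<in> carrier_mat k n" "R \<in> carrier_mat n m"
  shows "L * R * transpose_mat (L * R) = L * R * transpose_mat R * transpose_mat L"
proof -
  have "transpose_mat (L * R) = transpose_mat R * transpose_mat L"
    by (rule transpose_mult[OF assms])
  moreover have "L * R * transpose_mat R * transpose_mat L
      = L * R * (transpose_mat R * transpose_mat L)"
    using assms by (intro assoc_mult_mat[of _ k m _ n _ k]) auto
  ultimately show ?thesis by simp
qed

lemma cond_i_mult_iff:
  assumes S: "S \<in> Centr (F_mat d p)" and G: "G \<in> carrier_mat (n_min d p) m"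
  shows "cond_i d p (S * G) \<longleftrightarrow>
    zero_part d p S * rows_zero d p G * transpose_mat (rows_zero d p G)
        * transpose_mat (zero_part d p S)
      = 1\<^sub>m (\<Sum>i = 1..p. d i)"
proof -
  have "S \<in> carrier_mat (n_min d p) (n_min d p)" using S by (simp add: Centr_F_mat_iff)
  then show ?thesis
    unfolding cond_i_def rows_zero_mult[OF S G]
    by (simp only: mult_mult_transpose[OF zero_part_carrier rows_zero_carrier[OF G]])
qed

text \<open>Gram-Schmidt on the rows of the stack gives a lower triangular matrix. Higher levels
  come first, so its blocks with \<rho>1 > \<rho>2 lie above the diagonal and vanish.\<close>

lemma block_triangular_normalizer_exists:
  assumes G: "G \<in> carrier_mat (n_min d p) m" and rank: "full_row_rank (rows_zero d p G)"
  obtains L where "L \<in> carrier_mat (\<Sum>i = 1..p. d i) (\<Sum>i = 1..p. d i)" "block_lower_triangular d p L"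
    "L * rows_zero d p G * transpose_mat (rows_zero d p G) * transpose_mat L = 1\<^sub>m (\<Sum>i = 1..p. d i)"
proof -
  let ?n = "\<Sum>i = 1..p. d i" and ?R = "rows_zero d p G"
  note R = rows_zero_carrier[OF G]
  obtain l where l: "(\<forall>i j. i < j \<longrightarrow> l i j = 0) \<and> (\<forall>i<?n. \<forall>k<?n.
      (\<Sum>t<m. (\<Sum>j<?n. l i j * ?R $$ (j, t)) * (\<Sum>j<?n. l k j * ?R $$ (j, t))) = (if i
          = k then 1 else 0))"
    using triangular_orthonormalization[where w = "\<lambda>i t. ?R $$ (i, t)",
        OF full_row_rank_rows_independent[OF R rank]] by (rule exE)
  have tri: "l i j = 0" if "i < j" for i j using l that by simp
  have on: "(\<Sum>t<m. (\<Sum>j<?n. l i j * ?R $$ (j, t)) * (\<Sum>j<?n. l k j * ?R $$ (j, t)))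
      = (if i = k then 1 else 0)" if "i < ?n" "k < ?n" for i k
    by (rule l[THEN conjunct2, rule_format, OF that])
  define L where "L = mat ?n ?n (\<lambda>(i, j). l i j)"
  have L: "L \<in> carrier_mat ?n ?n" by (simp add: L_def)
  have LR: "L * ?R \<in> carrier_mat ?n m" by (rule mult_carrier_mat[OF L R])
  have LR_index: "(L * ?R) $$ (i, t) = (\<Sum>j<?n. l i j * ?R $$ (j, t))" if "i < ?n" "t < m" for i t
    unfolding mult_mat_eq_sum[OF L R that] using that by (intro sum.cong) (auto simp: L_def)
  have "block_lower_triangular d p L"
    unfolding block_lower_triangular_iff[OF L]
  proof (intro ballI impI)
    fix x y assume xy: "x \<in> levels d p" "y \<in> levels d p" "fst y < fst x"
    then have "level_pos d p x < level_pos d p y"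
      using level_pos_less[of "fst x" "snd x" d p "fst y" "snd y"] by
          (simp del: level_pos.simps levels_iff)
    then show "L $$ (level_pos d p x, level_pos d p y) = 0"
      using level_pos_lt_sum[OF xy(1)] level_pos_lt_sum[OF xy(2)] tri
          by (simp only: L_def index_mat split)
  qed
  moreover have "L * ?R * transpose_mat (L * ?R) = 1\<^sub>m ?n"
  proof (rule eq_matI)
    fix i k assume "i < dim_row (1\<^sub>m ?n :: real mat)" "k < dim_col (1\<^sub>m ?n :: real mat)"
    then have ik: "i < ?n" "k < ?n" by simp_all
    have "(L * ?R * transpose_mat (L * ?R)) $$ (i, k)
        = (\<Sum>t<m. (L * ?R) $$ (i, t) * (L * ?R) $$ (k, t))"
      by (rule mult_transpose_eq_sum[OF LR LR ik])
    also have "\<dots> = (if i = k then 1 else 0)"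
      unfolding on[OF ik, symmetric] by (intro sum.cong refl) (simp only: LR_index ik lessThan_iff)
    finally show "(L * ?R * transpose_mat (L * ?R)) $$ (i, k) = 1\<^sub>m ?n $$ (i, k)"
      using ik by (simp only: index_one_mat)
  qed (use L R in auto)
  ultimately show thesis
    using that[OF L] mult_mult_transpose[OF L R] by metis
qed

text \<open>Writing \<open>S\<close> as a \<open>toeplitz t\<close>, the zero part fixes
  \<open>t 0\<close> and (ii) fixes every later \<open>t k\<close> through \<open>level_rhs\<close>,
  in each case on the support of \<open>toeplitz\<close>.\<close>

lemma centralizer_solution:
  assumes G: "G \<in> carrier_mat (n_min d p) m"
    and L: "L \<in> carrier_mat (\<Sum>i = 1..p. d i) (\<Sum>i = 1..p. d i)"
    and blt: "block_lower_triangular d p L"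
    and norm: "L * rows_zero d p G * transpose_mat (rows_zero d p G) * transpose_mat L
      = 1\<^sub>m (\<Sum>i = 1..p. d i)"
  shows "\<exists>!S. S \<in> Centr (F_mat d p) \<and> zero_part d p S = L \<and> cond_ii d p (S * G)"
proof -
  let ?n = "\<Sum>i = 1..p. d i" and ?R = "rows_zero d p G"
  note R = rows_zero_carrier[OF G]
  have LR: "L * ?R \<in> carrier_mat ?n m" by (rule mult_carrier_mat[OF L R])
  define g where "g x c = G $$ (block_pos d p x, c)" for x c
  define l where "l x y = L $$ (level_pos d p x, level_pos d p y)" for x y
  define q where "q x c = (L * ?R) $$ (level_pos d p x, c)" for x c
  interpret orthonormal_zero_rows d p m g l q
  proof
    show "l x y = 0" if "x \<in> levels d p" "y \<in> levels d p" "fst y < fst x" for x y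
      using blt that unfolding block_lower_triangular_iff[OF L] l_def by blast
    show "q x c = (\<Sum>y\<in>levels d p. l x y * g (at_zero y) c)" if "x \<in> levels d p" "c < m" for x c
      unfolding q_def l_def g_def mult_mat_level_pos[OF L R that]
      using that by (intro sum.cong refl) (simp only: rows_zero_index[OF G])
    show "(\<Sum>c<m. q x c * q y c) = (if x = y then 1 else 0)" if xy: "x \<in> levels d p" "y \<in> levels d p"
        for x y
    proof -
      note lt = level_pos_lt_sum[OF xy(1)] level_pos_lt_sum[OF xy(2)]
      have "(\<Sum>c<m. q x c * q y c)
          = (L * ?R * transpose_mat (L * ?R)) $$ (level_pos d p x, level_pos d p y)"
        unfolding q_def by (rule mult_transpose_eq_sum[OF LR LR lt, symmetric])
      also have "\<dots> = (1\<^sub>m ?n :: real mat) $$ (level_pos d p x, level_pos d p y)"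
        by (simp only: mult_mult_transpose[OF L R] norm)
      also have "\<dots> = (if x = y then 1 else 0)"
        unfolding index_one_mat(1)[OF lt] using inj_on_eq_iff[OF inj_level_pos xy] by simp
      finally show ?thesis .
    qed
  qed
  have act: "(S * G) $$ (block_pos d p x, c) = (\<Sum>y\<in>blocks d p. toeplitz t x y * g y c)"
    if "S \<in> carrier_mat (n_min d p) (n_min d p)"
      and "\<forall>x\<in>blocks d p. \<forall>y\<in>blocks d p. S $$ (block_pos d p x, block_pos d p y) = toeplitz t x y"
      and "x \<in> blocks d p" "c < m" for S t x c
    unfolding mult_mat_block_pos[OF that(1) G that(3,4)] g_def
    by (intro sum.cong refl) (simp only: that)
  \<comment> \<open>Where \<open>fst y < fst x\<close>, both sides are 0: the zero part by the shape
    of \<open>toeplitz\<close>, \<open>L\<close> by triangularity.\<close>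
  have zero_part_iff: "zero_part d p S = L \<longleftrightarrow>
      (\<forall>x\<in>levels d p. \<forall>y\<in>levels d p. fst x \<le> fst y \<longrightarrow> t 0 x y = l x y)"
    if S: "S \<in> carrier_mat (n_min d p) (n_min d p)"
      and t: "\<forall>x\<in>blocks d p. \<forall>y\<in>blocks d p. S $$ (block_pos d p x, block_pos d p y)
          = toeplitz t x y" for S t
  proof -
    have "zero_part d p S = L \<longleftrightarrow>
      (\<forall>i<?n. \<forall>k<?n. zero_part d p S $$ (i, k) = L $$ (i, k))"
      using carrier_matD[OF zero_part_carrier[OF S]] carrier_matD[OF L] unfolding mat_eq_iff by simp
    also have "\<dots> \<longleftrightarrow> (\<forall>x\<in>levels d p. \<forall>y\<in>levels d p.
        zero_part d p S $$ (level_pos d p x, level_pos d p y)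
            = L $$ (level_pos d p x, level_pos d p y))"
      by (simp only: all_level_pos)
    also have "\<dots> \<longleftrightarrow> (\<forall>x\<in>levels d p. \<forall>y\<in>levels d p. toeplitz t (at_zero x) (at_zero y) = l x y)"
      unfolding l_def by (intro ball_cong refl) (simp only: zero_part_index[OF S] t at_zero_blocks)
    also have "\<dots> \<longleftrightarrow> (\<forall>x\<in>levels d p. \<forall>y\<in>levels d p. fst x \<le> fst y \<longrightarrow> t 0 x y = l x y)"
    proof (intro ball_cong refl)
      fix x y assume "x \<in> levels d p" "y \<in> levels d p"
      then show "toeplitz t (at_zero x) (at_zero y) = l x y \<longleftrightarrow> (fst x \<le> fst y \<longrightarrow> t 0 x y = l x y)"
        using tri[of x y] by (cases x; cases y) (auto simp: not_le)
    qed
    finally show ?thesis .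
  qed
  \<comment> \<open>Once the zero part is \<open>L\<close>, the rows of \<open>S * G\<close> with
    \<open>j = 0\<close> are the fixed vectors \<open>q\<close>; this is what makes (ii) linear in
    the remaining \<open>t k\<close>.\<close>
  have cond_ii_iff_level_rhs: "cond_ii d p (S * G) \<longleftrightarrow> (\<forall>r k a. (r, k, a) \<in> blocks d p \<longrightarrow> 0 < k \<longrightarrow>
      (\<forall>y\<in>{y\<in>levels d p. r - k \<le> fst y}. t k (r, a) y = level_rhs t k (r, a) y))"
    if S: "S \<in> carrier_mat (n_min d p) (n_min d p)"
      and t: "\<forall>x\<in>blocks d p. \<forall>y\<in>blocks d p. S $$ (block_pos d p x, block_pos d p y)
          = toeplitz t x y"
      and t0: "\<forall>x\<in>levels d p. \<forall>y\<in>levels d p. fst x \<le> fst y \<longrightarrow> t 0 x y = l x y" for S t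
  proof -
    have SG: "S * G \<in> carrier_mat (n_min d p) m" by (rule mult_carrier_mat[OF S G])
    have zero_rows: "(S * G) $$ (block_pos d p (at_zero z), c)
        = q z c" if z: "z \<in> levels d p" "c < m" for z c
    proof -
      have "(S * G) $$ (block_pos d p (at_zero z), c)
          = (\<Sum>y\<in>levels d p. toeplitz t (at_zero z) (at_zero y) * g (at_zero y) c)"
        unfolding act[OF S t at_zero_blocks[OF z(1)] z(2)] by (rule sum_toeplitz_at_zero[OF z(1)])
      also have "\<dots> = (\<Sum>y\<in>levels d p. l z y * g (at_zero y) c)"
      proof (intro sum.cong refl)
        fix y assume "y \<in> levels d p"
        then show "toeplitz t (at_zero z) (at_zero y) * g (at_zero y) c = l z y * g (at_zero y) c"
          using t0 tri[of z y] z by (cases z; cases y) (auto simp: not_le)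
      qed
      also have "\<dots> = q z c" using q[OF z] by simp
      finally show ?thesis .
    qed
    have "cond_ii d p (S * G) \<longleftrightarrow> (\<forall>r k a. (r, k, a) \<in> blocks d p \<longrightarrow> 0 < k \<longrightarrow>
      (\<forall>z\<in>{z\<in>levels d p. r - k \<le> fst z}.
        (\<Sum>c<m. (S * G) $$ (block_pos d p (r, k, a), c) * (S * G) $$ (block_pos d p (at_zero z), c))
            = 0))"
      unfolding cond_ii_iff[OF SG]
      by (simp add: Ball_def split_paired_All le_diff_conv add.commute Suc_le_eq
          del: block_pos.simps blocks_iff levels_iff at_zero.simps) blast
    also have "\<dots> \<longleftrightarrow> (\<forall>r k a. (r, k, a) \<in> blocks d p \<longrightarrow> 0 < k \<longrightarrow>
      (\<forall>z\<in>{z\<in>levels d p. r - k \<le> fst z}.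
        (\<Sum>c<m. (\<Sum>y\<in>blocks d p. toeplitz t (r, k, a) y * g y c) * q z c) = 0))"
    proof (intro all_cong1 imp_cong ball_cong refl)
      fix r k a z assume x: "(r, k, a) \<in> blocks d p" and z: "z \<in> {z\<in>levels d p. r - k \<le> fst z}"
      have "(\<Sum>c<m. (S * G) $$ (block_pos d p (r, k, a), c) * (S
          * G) $$ (block_pos d p (at_zero z), c))
          = (\<Sum>c<m. (\<Sum>y\<in>blocks d p. toeplitz t (r, k, a) y * g y c) * q z c)"
        using z by (intro sum.cong refl) (simp only: act[OF S t x] zero_rows lessThan_iff mem_Collect_eq)
      then show "((\<Sum>c<m. (S * G) $$ (block_pos d p (r, k, a), c) * (S
          * G) $$ (block_pos d p (at_zero z), c)) = 0)
          = ((\<Sum>c<m. (\<Sum>y\<in>blocks d p. toeplitz t (r, k, a) y * g y c) * q z c) = 0)" by (simp only:)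
    qed
    finally show ?thesis by (simp only: orthogonality_iff)
  qed
  show ?thesis
  proof (rule ex_ex1I)
    obtain t where t: "t 0 = l"
      "\<And>r k a. (r, k, a) \<in> blocks d p \<Longrightarrow> 0 < k \<Longrightarrow> t k (r, a) = level_rhs t k (r, a)"
      using solution_exists by blast
    \<comment> \<open>The labels are recovered from the positions, so that \<open>S\<close> can be
      defined entrywise.\<close>
    define block_pos' where "block_pos' = the_inv_into (blocks d p) (block_pos d p)"
    define S where "S = mat (n_min d p) (n_min d p) (\<lambda>(i, k). toeplitz t (block_pos' i) (block_pos' k))"
    have S: "S \<in> carrier_mat (n_min d p) (n_min d p)" by (simp add: S_def)
    have S_index: "\<forall>x\<in>blocks d p. \<forall>y\<in>blocks d p. S $$ (block_pos d p x, block_pos d p y)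
        = toeplitz t x y"
      unfolding S_def
      by (intro ballI)
        (simp only: index_mat block_pos_lt_n_min split block_pos'_def the_inv_into_f_f[OF inj_block_pos])
    have "det S \<noteq> 0"
    proof
      assume "det S = 0"
      then obtain v where v: "v \<in> carrier_vec (n_min d p)" "v \<noteq> 0\<^sub>v (n_min d p)" "S *\<^sub>v v
          = 0\<^sub>v (n_min d p)"
        using det_0_iff_vec_prod_zero_field[OF S] by blast
      have "v $ block_pos d p x = 0" if "x \<in> blocks d p" for x
      proof -
        have "(\<Sum>y\<in>blocks d p. toeplitz t x y * v $ block_pos d p y)
            = 0" if x: "x \<in> blocks d p" for x
        proof -
          have "(\<Sum>y\<in>blocks d p. toeplitz t x y * v $ block_pos d p y)
              = (\<Sum>y\<in>blocks d p. S $$ (block_pos d p x, block_pos d p y) * v $ block_pos d p y)"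
            using x by (intro sum.cong refl) (simp only: S_index)
          also have "\<dots> = (\<Sum>i<n_min d p. S $$ (block_pos d p x, i) * v $ i)"
            by (simp only: sum_block_pos)
          also have "\<dots> = (S *\<^sub>v v) $ block_pos d p x"
            using S v(1) block_pos_lt_n_min[OF x] by (simp add: scalar_prod_def atLeast0LessThan
            del: block_pos.simps)
          also have "\<dots> = 0" using v(3) block_pos_lt_n_min[OF x] by simp
          finally show ?thesis .
        qed
        then show ?thesis
          using toeplitz_kernel_trivial[of t "\<lambda>y. v $ block_pos d p y" "fst x" "fst (snd x)" "snd (snd x)"] that t(1)
          by (simp del: block_pos.simps blocks_iff)
      qed
      then have "v = 0\<^sub>v (n_min d p)"
        using v(1) by (intro eq_vecI) (auto elim!: block_pos_cases simp del: block_pos.simps)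
      then show False using v(2) by simp
    qed
    then have "invertible_mat S" by (rule invertible_mat_if_det_nonzero[OF S])
    then have "S \<in> Centr (F_mat d p)" using S S_index by (auto simp: Centr_F_mat_iff)
    moreover have "zero_part d p S = L" using zero_part_iff[OF S S_index] t(1) by simp
    moreover have "cond_ii d p (S * G)"
      using cond_ii_iff_level_rhs[OF S S_index] t by simp
    ultimately show "\<exists>S. S \<in> Centr (F_mat d p) \<and> zero_part d p S = L \<and> cond_ii d p (S * G)" by blast
  next
    fix S S'
    assume "S \<in> Centr (F_mat d p) \<and> zero_part d p S = L \<and> cond_ii d p (S * G)"
      and "S' \<in> Centr (F_mat d p) \<and> zero_part d p S' = L \<and> cond_ii d p (S' * G)"
    then obtain t t' where S: "S \<in> carrier_mat (n_min d p) (n_min d p)" "zero_part d p S = L"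
        "cond_ii d p (S * G)"
        "\<forall>x\<in>blocks d p. \<forall>y\<in>blocks d p. S $$ (block_pos d p x, block_pos d p y) = toeplitz t x y"
      and S': "S' \<in> carrier_mat (n_min d p) (n_min d p)" "zero_part d p S' = L"
        "cond_ii d p (S' * G)"
        "\<forall>x\<in>blocks d p. \<forall>y\<in>blocks d p. S' $$ (block_pos d p x, block_pos d p y) = toeplitz t' x y"
      unfolding Centr_F_mat_iff by blast
    have t0: "\<forall>x\<in>levels d p. \<forall>y\<in>levels d p. fst x \<le> fst y \<longrightarrow> t 0 x y = l x y"
      "\<forall>x\<in>levels d p. \<forall>y\<in>levels d p. fst x \<le> fst y \<longrightarrow> t' 0 x y = l x y"
      using zero_part_iff[OF S(1,4)] zero_part_iff[OF S'(1,4)] S(2) S'(2) by blast+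
    \<comment> \<open>\<open>t\<close> and \<open>t'\<close> need not coincide, but they do on all
      entries that \<open>toeplitz\<close> reads, and these determine the matrices.\<close>
    have t_eq: "t k (r, a) y = t' k (r, a) y"
      if "(r, k, a) \<in> blocks d p" "y \<in> levels d p" "r - k \<le> fst y" for r k a y
    proof (rule solution_unique[OF _ _ _ that])
      show "t 0 x y = t' 0 x y" if "x \<in> levels d p" "y \<in> levels d p" "fst x \<le> fst y" for x y
        using t0 that by simp
      show "t k (r, a) y = level_rhs t k (r, a) y"
        if "(r, k, a) \<in> blocks d p" "0 < k" "y \<in> levels d p" "r - k \<le> fst y" for r k a y
        using cond_ii_iff_level_rhs[OF S(1,4) t0(1)] S(3) that by blast
      show "t' k (r, a) y = level_rhs t' k (r, a) y"
        if "(r, k, a) \<in> blocks d p" "0 < k" "y \<in> levels d p" "r - k \<le> fst y" for r k a y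
        using cond_ii_iff_level_rhs[OF S'(1,4) t0(2)] S'(3) that by blast
    qed
    show "S = S'"
      unfolding mat_eq_block_pos_iff[OF S(1) S'(1)]
    proof (intro ballI)
      fix x y assume xy: "x \<in> blocks d p" "y \<in> blocks d p"
      obtain r j a r' j' a' where x: "x = (r, j, a)" and y: "y = (r', j', a')" by (cases x; cases y)
      have "toeplitz t x y = toeplitz t' x y"
        using xy t_eq[of r "j - j'" a "(r', a')"] by (auto simp: x y)
      then show "S $$ (block_pos d p x, block_pos d p y) = S' $$ (block_pos d p x, block_pos d p y)"
        using S(4) S'(4) xy by simp
    qed
  qed
qed

theorem proposition3:
  fixes d :: "nat \<Rightarrow> nat" and p k m :: nat and G :: "real mat"
  assumes "p \<ge> 1" and "d p > 0"
    and "(\<Sum>i = 1..p. d i) \<le> min k m"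
    and "G \<in> carrier_mat (n_min d p) m"
    and "full_row_rank (rows_zero d p G)"
  shows
    "(\<exists>S \<in> Centr (F_mat d p). cond_i d p (S * G) \<and> cond_ii d p (S * G))
     \<and> (\<forall>S \<in> Centr (F_mat d p).
          cond_i d p (S * G) \<longleftrightarrow>
            zero_part d p S * rows_zero d p G * transpose_mat (rows_zero d p G)
              * transpose_mat (zero_part d p S) = 1\<^sub>m (\<Sum>i = 1..p. d i))
     \<and> (\<forall>L \<in> carrier_mat (\<Sum>i = 1..p. d i) (\<Sum>i = 1..p. d i).
          block_lower_triangular d p L
          \<and> L * rows_zero d p G * transpose_mat (rows_zero d p G) * transpose_mat L
              = 1\<^sub>m (\<Sum>i = 1..p. d i)
          \<longrightarrow>
          (\<exists>S \<in> Centr (F_mat d p).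
             zero_part d p S = L \<and> cond_i d p (S * G) \<and> cond_ii d p (S * G))
          \<and> (\<exists>!S. S \<in> Centr (F_mat d p) \<and> zero_part d p S = L \<and> cond_ii d p (S * G)))"
proof (intro conjI ballI impI)
  note G = assms(4)
  obtain L where L: "L \<in> carrier_mat (\<Sum>i = 1..p. d i) (\<Sum>i = 1..p. d i)"
      "block_lower_triangular d p L"
      "L * rows_zero d p G * transpose_mat (rows_zero d p G) * transpose_mat L = 1\<^sub>m (\<Sum>i
          = 1..p. d i)"
    using block_triangular_normalizer_exists[OF G assms(5)] by blast
  \<comment> \<open>Condition (i) for this \<open>S\<close> comes with the choice of
    \<open>L\<close>, since it is a condition on the zero part.\<close>
  obtain S where "S \<in> Centr (F_mat d p)" "zero_part d p S = L" "cond_ii d p (S * G)"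
    using centralizer_solution[OF G L] by blast
  then show "\<exists>S \<in> Centr (F_mat d p). cond_i d p (S * G) \<and> cond_ii d p (S * G)"
    using cond_i_mult_iff[OF _ G] L(3) by metis
next
  fix S assume "S \<in> Centr (F_mat d p)"
  then show "cond_i d p (S * G) \<longleftrightarrow> zero_part d p S * rows_zero d p G
      * transpose_mat (rows_zero d p G) * transpose_mat (zero_part d p S) = 1\<^sub>m (\<Sum>i = 1..p. d i)"
    by (rule cond_i_mult_iff[OF _ assms(4)])
next
  fix L :: "real mat"
  assume L: "L \<in> carrier_mat (\<Sum>i = 1..p. d i) (\<Sum>i = 1..p. d i)"
    and *: "block_lower_triangular d p L
      \<and> L * rows_zero d p G * transpose_mat (rows_zero d p G) * transpose_mat L
        = 1\<^sub>m (\<Sum>i = 1..p. d i)"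
  show unique: "\<exists>!S. S \<in> Centr (F_mat d p) \<and> zero_part d p S = L \<and> cond_ii d p (S * G)"
    using centralizer_solution[OF assms(4) L] * by blast
  then obtain S where "S \<in> Centr (F_mat d p)" "zero_part d p S = L" "cond_ii d p (S * G)"
    by blast
  then show "\<exists>S \<in> Centr (F_mat d p). zero_part d p S = L \<and> cond_i d p (S * G) \<and> cond_ii d p (S * G)"
    using cond_i_mult_iff[OF _ assms(4)] * by metis
qed

end
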